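(* Let $R$ be a nearly simple domain, and let $J$ be its Jacobson radical. Then: (i) $\mathrm{W}(J)\cong\mathbb{N}$, with its usual order. (ii) $\mathrm{W}(R)\cong\mathbb{N}\times\mathbb{N}$, with the order $$(r',s')\le(r,s)\iff r'+s'\le r+s\quad\text{and}\quad r'\le r.$$
   Context: $\mathbb{N}$ contains $0$. A unital ring is uniserial if its right ideals are totally ordered by inclusion and so are its left ideals. A nearly simple domain is a uniserial domain $R$ that is not simple and whose only two-sided ideals are $\{0\}$, the Jacobson radical $J(R)$, and $R$. A (not necessarily unital) ring $S$ is weakly $s$-unital if for every $n\ge1$ and every $a\in M_n(S)$ there are $b,c\in M_n(S)$ with $a=bac$; both $R$ and $J$ are weakly $s$-unital. For a weakly $s$-unital ring $S$, let $M_\infty(S)$ be the ring of $\mathbb{N}\times\mathbb{N}$ matrices over $S$ with finitely many nonzero entries, and write $a\precsim_1b$ if $a=rbt$ for some $r,t\in M_\infty(S)$. $\mathrm{W}(S)$ is $M_\infty(S)$ modulo the antisymmetrization of $\precsim_1$, with order induced by $\precsim_1$ and addition $[a]+[b]=\left[\begin{pmatrix}a&0\\0&b\end{pmatrix}\right]$ (block sum of finite representatives). The isomorphisms are isomorphisms of ordered monoids. *)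

theory Defs
  imports "HOL-Algebra.Group" "HOL-Library.Groups_Big_Fun"
begin

section \<open>Nearly simple domains\<close>

text \<open>The ring \<open>R\<close> is a type of class \<open>ring_1_no_zero_divisors\<close>: a nonzero, not necessarily
  commutative, unital ring without zero divisors. Ideals and subrings are subsets of the type.\<close>

definition right_ideal :: "'a::ring_1 set \<Rightarrow> bool" where
  "right_ideal I \<longleftrightarrow> 0 \<in> I \<and> (\<forall>x\<in>I. \<forall>y\<in>I. x - y \<in> I) \<and> (\<forall>x\<in>I. \<forall>r. x * r \<in> I)"

definition left_ideal :: "'a::ring_1 set \<Rightarrow> bool" where
  "left_ideal I \<longleftrightarrow> 0 \<in> I \<and> (\<forall>x\<in>I. \<forall>y\<in>I. x - y \<in> I) \<and> (\<forall>x\<in>I. \<forall>r. r * x \<in> I)"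

definition two_sided_ideal :: "'a::ring_1 set \<Rightarrow> bool" where
  "two_sided_ideal I \<longleftrightarrow> left_ideal I \<and> right_ideal I"

definition maximal_right_ideal :: "'a::ring_1 set \<Rightarrow> bool" where
  "maximal_right_ideal M \<longleftrightarrow> right_ideal M \<and> M \<noteq> UNIV \<and>
     (\<forall>I. right_ideal I \<and> M \<subseteq> I \<longrightarrow> I = M \<or> I = UNIV)"

definition jacobson_radical :: "'a::ring_1 set" where
  "jacobson_radical = \<Inter> {M. maximal_right_ideal M}"

definition uniserial :: "'a::ring_1 itself \<Rightarrow> bool" where
  "uniserial _ \<longleftrightarrow>
     (\<forall>I K :: 'a set. right_ideal I \<and> right_ideal K \<longrightarrow> I \<subseteq> K \<or> K \<subseteq> I) \<and>
     (\<forall>I K :: 'a set. left_ideal I \<and> left_ideal K \<longrightarrow> I \<subseteq> K \<or> K \<subseteq> I)"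

definition simple_ring :: "'a::ring_1 itself \<Rightarrow> bool" where
  "simple_ring _ \<longleftrightarrow> (\<forall>I :: 'a set. two_sided_ideal I \<longrightarrow> I = {0} \<or> I = UNIV)"

definition nearly_simple_domain :: "'a::ring_1_no_zero_divisors itself \<Rightarrow> bool" where
  "nearly_simple_domain _ \<longleftrightarrow> uniserial TYPE('a) \<and> \<not> simple_ring TYPE('a) \<and>
     {I :: 'a set. two_sided_ideal I} = {{0}, jacobson_radical, UNIV}"


section \<open>Ordered commutative monoids\<close>

text \<open>As in HOL-Algebra, the record fields are written multiplicatively.\<close>

record 'a ordered_monoid = "'a monoid" +
  ord_le :: "'a \<Rightarrow> 'a \<Rightarrow> bool"

locale ordered_comm_monoid = comm_monoid M for M (structure) +
  assumes ord_refl: "x \<in> carrier M \<Longrightarrow> ord_le M x x"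
    and ord_antisym: "\<lbrakk>x \<in> carrier M; y \<in> carrier M; ord_le M x y; ord_le M y x\<rbrakk> \<Longrightarrow> x = y"
    and ord_trans: "\<lbrakk>x \<in> carrier M; y \<in> carrier M; z \<in> carrier M;
      ord_le M x y; ord_le M y z\<rbrakk> \<Longrightarrow> ord_le M x z"
    and ord_mult_mono: "\<lbrakk>x \<in> carrier M; y \<in> carrier M; z \<in> carrier M; ord_le M x y\<rbrakk>
      \<Longrightarrow> ord_le M (x \<otimes> z) (y \<otimes> z)"

definition ordered_monoid_isomorphic ::
    "'a ordered_monoid \<Rightarrow> 'b ordered_monoid \<Rightarrow> bool" where
  "ordered_monoid_isomorphic M N \<longleftrightarrow> ordered_comm_monoid M \<and> ordered_comm_monoid N \<and>
     (\<exists>h \<in> iso M N. h \<one>\<^bsub>M\<^esub> = \<one>\<^bsub>N\<^esub> \<and>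
        (\<forall>x\<in>carrier M. \<forall>y\<in>carrier M. ord_le M x y \<longleftrightarrow> ord_le N (h x) (h y)))"

definition nat_ordered_monoid :: "nat ordered_monoid" where
  "nat_ordered_monoid = \<lparr>carrier = UNIV, mult = (+), one = 0, ord_le = (\<le>)\<rparr>"

definition nat_pair_ordered_monoid :: "(nat \<times> nat) ordered_monoid" where
  "nat_pair_ordered_monoid = \<lparr>carrier = UNIV,
     mult = (\<lambda>(r, s) (r', s'). (r + r', s + s')), one = (0, 0),
     ord_le = (\<lambda>(r', s') (r, s). r' + s' \<le> r + s \<and> r' \<le> r)\<rparr>"


section \<open>The ordered monoid \<open>W(S)\<close> of a subring \<open>S\<close>\<close>

type_synonym 'a inf_mat = "nat \<Rightarrow> nat \<Rightarrow> 'a"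

definition M_inf :: "'a::ring set \<Rightarrow> 'a inf_mat set" where
  "M_inf S = {a. (\<forall>i j. a i j \<in> S) \<and> finite {(i, j). a i j \<noteq> 0}}"

definition inf_mat_mult :: "'a::ring inf_mat \<Rightarrow> 'a inf_mat \<Rightarrow> 'a inf_mat" (infixl "**\<^sub>\<infinity>" 70) where
  "a **\<^sub>\<infinity> b = (\<lambda>i k. Sum_any (\<lambda>j. a i j * b j k))"

definition precsim1 :: "'a::ring set \<Rightarrow> 'a inf_mat \<Rightarrow> 'a inf_mat \<Rightarrow> bool" where
  "precsim1 S a b \<longleftrightarrow> (\<exists>r \<in> M_inf S. \<exists>t \<in> M_inf S. a = r **\<^sub>\<infinity> b **\<^sub>\<infinity> t)"

definition W_rel :: "'a::ring set \<Rightarrow> ('a inf_mat \<times> 'a inf_mat) set" where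
  "W_rel S = {(a, b) \<in> M_inf S \<times> M_inf S. precsim1 S a b \<and> precsim1 S b a}"

text \<open>\<open>supported_below n a\<close> says that \<open>a\<close> is an \<open>n \<times> n\<close> matrix padded by zeros, and
  \<open>block_sum n a b\<close> then is the block diagonal matrix with this \<open>n \<times> n\<close> block followed by \<open>b\<close>.\<close>

definition supported_below :: "nat \<Rightarrow> 'a::ring inf_mat \<Rightarrow> bool" where
  "supported_below n a \<longleftrightarrow> (\<forall>i j. n \<le> i \<or> n \<le> j \<longrightarrow> a i j = 0)"

definition block_sum :: "nat \<Rightarrow> 'a::ring inf_mat \<Rightarrow> 'a inf_mat \<Rightarrow> 'a inf_mat" where
  "block_sum n a b = (\<lambda>i j. if i < n \<and> j < n then a i j
     else if n \<le> i \<and> n \<le> j then b (i - n) (j - n) else 0)"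

text \<open>Elements of \<open>W(S)\<close> are equivalence classes of \<open>W_rel S\<close>. The sum of two classes is the
  union of the classes of \<open>block_sum n a b\<close> over all representatives \<open>a\<close>, \<open>b\<close> and all admissible
  block sizes \<open>n\<close>; when the addition is well defined, all of these coincide.

  The definition is total in \<open>S\<close>. If \<open>S\<close> is not weakly \<open>s\<close>-unital, then \<open>precsim1 S\<close> is not
  reflexive on \<open>M_inf S\<close>, some class \<open>W_rel S `` {a}\<close> is empty, and \<open>ord_le\<close> fails to be reflexive
  at it. So \<open>ordered_comm_monoid (W S)\<close>, and with it any \<open>ordered_monoid_isomorphic (W S) N\<close>,
  entails for a subring \<open>S\<close> that \<open>S\<close> is weakly \<open>s\<close>-unital and that \<open>W_rel S\<close> is an equivalence
  relation on \<open>M_inf S\<close>.\<close>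

definition W :: "'a::ring set \<Rightarrow> 'a inf_mat set ordered_monoid" where
  "W S = \<lparr>carrier = M_inf S // W_rel S,
     mult = (\<lambda>X Y. \<Union> {W_rel S `` {block_sum n a b} | n a b.
                         a \<in> X \<and> b \<in> Y \<and> supported_below n a}),
     one = W_rel S `` {\<lambda>i j. 0},
     ord_le = (\<lambda>X Y. \<exists>a\<in>X. \<exists>b\<in>Y. precsim1 S a b)\<rparr>"

end

(* Since R is a chain domain, x - y lies in xR or in yR. Hence for a in J the set of all products
   r a t with r, t in J is an ideal, and by near simplicity all nonzero elements of J are
   interchangeable in diagonal matrices. Gaussian elimination with pivots generating the right
   ideal of their row brings every finite matrix, up to the preorder, to the form
   diag(1,...,1,a,...,a) with r ones and s copies of a fixed nonzero a in J. Solving a homogeneous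
   linear system with more unknowns than equations (one coordinate of the solution can be made 1)
   shows that the number of diagonal entries outside a two-sided ideal is monotone; the ideals 0
   and J give r + s and r. Over J the same matrices with r = 0 occur, and the preorder over R
   restricts to the one over J because a = r a t with r, t in J. *)

theory Submission
  imports Defs
begin

subsection \<open>The ring of finitely supported matrices\<close>

text \<open>A non-unit pivot is the obstacle: column operations clear its row, but the entries of
  its column need not be left multiples of it, so row operations need not clear the column.
  Therefore no diagonalization by invertible matrices is sought. A lower and an upper bound for
  \<open>A\<close> are built separately: the lower one is an equation
  \<open>X * A * Y = diag n e\<close>, the upper one a factorization \<open>A = P * Q\<close> with
  inner size \<open>n\<close>, in which column \<open>k\<close> of \<open>P\<close> has all entries
  in J whenever \<open>e k\<close> is not 1. Such a column consists of left multiples of one nonzero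
  element of J; that element need not be \<open>e k\<close>, but the two are interchangeable, so the
  bounds meet. The order on pairs is not componentwise because \<open>a = a * 1 * 1\<close>: a unit
  can take the place of a non-unit, never conversely.\<close>

typedef (overloaded) 'a fmat = "M_inf (UNIV :: 'a::ring set)"
  morphisms ent Mat
proof
  show "(\<lambda>_ _. 0) \<in> M_inf (UNIV :: 'a set)"
    by (simp add: M_inf_def)
qed

lemma fmat_eqI: "(\<And>i j. ent A i j = ent B i j) \<Longrightarrow> A = B"
  by (simp add: ent_inject[symmetric] fun_eq_iff)

lemma finite_support_iff_supported_below:
  "finite {(i, j). f i j \<noteq> 0} \<longleftrightarrow> (\<exists>n. supported_below n f)" (is "finite ?S \<longleftrightarrow> _")
proof
  assume "finite ?S"
  then have "finite (fst ` ?S \<union> snd ` ?S)"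
    by blast
  then obtain n where n: "\<forall>k\<in>fst ` ?S \<union> snd ` ?S. k < n"
    by (meson finite_nat_set_iff_bounded)
  have "supported_below n f"
    unfolding supported_below_def
  proof (intro allI impI)
    fix i j assume "n \<le> i \<or> n \<le> j"
    show "f i j = 0"
    proof (rule ccontr)
      assume "f i j \<noteq> 0"
      then have "i \<in> fst ` ?S" "j \<in> snd ` ?S"
        by force+
      with n have "i < n" "j < n"
        by blast+
      with \<open>n \<le> i \<or> n \<le> j\<close> show False
        by linarith
    qed
  qed
  then show "\<exists>n. supported_below n f" ..
next
  assume "\<exists>n. supported_below n f"
  then obtain n where "supported_below n f" ..
  then have "?S \<subseteq> {..<n} \<times> {..<n}"
    by (force simp: supported_below_def not_le[symmetric])
  then show "finite ?S"
    by (rule finite_subset) simp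
qed

lemma M_inf_iff: "f \<in> M_inf S \<longleftrightarrow> (\<forall>i j. f i j \<in> S) \<and> (\<exists>n. supported_below n f)"
  by (simp add: M_inf_def finite_support_iff_supported_below)

lemma supported_below_mono: "supported_below m f \<Longrightarrow> m \<le> n \<Longrightarrow> supported_below n f"
  by (auto simp: supported_below_def)

lemma ent_supported: "\<exists>n. supported_below n (ent A)"
  using ent[of A] by (simp add: M_inf_iff)

lemma ent_Mat: "supported_below n f \<Longrightarrow> ent (Mat f) = f"
  by (rule Mat_inverse) (auto simp: M_inf_iff)

lemma Sum_any_lessThan:
  fixes g :: "nat \<Rightarrow> 'b::comm_monoid_add"
  assumes "\<And>j. n \<le> j \<Longrightarrow> g j = 0"
  shows "Sum_any g = sum g {..<n}"
  by (rule Sum_any.expand_superset) (use assms not_less in auto)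

lemma inf_mat_mult_lessThan:
  assumes "supported_below n f"
  shows "(f **\<^sub>\<infinity> g) i k = (\<Sum>j<n. f i j * g j k)"
  unfolding inf_mat_mult_def
  by (rule Sum_any_lessThan) (use assms in \<open>auto simp: supported_below_def\<close>)

lemma supported_below_mult:
  assumes "supported_below n f" "supported_below n g"
  shows "supported_below n (f **\<^sub>\<infinity> g)"
  using assms by (auto simp: supported_below_def inf_mat_mult_lessThan[OF assms(1)])

text \<open>As a type of class \<open>ring\<close>, matrices come with associativity, distributivity
  and \<open>algebra_simps\<close>; there is no unit, but \<open>idm n\<close> acts as a local one.
  Entries in a subset such as J become a side condition, so both monoids are treated in one
  type.\<close>

instantiation fmat :: (ring) ring
begin

definition "0 = Mat (\<lambda>_ _. 0)"
definition "A + B = Mat (\<lambda>i j. ent A i j + ent B i j)"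
definition "A - B = Mat (\<lambda>i j. ent A i j - ent B i j)"
definition "- A = Mat (\<lambda>i j. - ent A i j)"
definition "A * B = Mat (ent A **\<^sub>\<infinity> ent B)"

lemma ent_supported_common:
  obtains n where "supported_below n (ent A)" "supported_below n (ent B)" "supported_below n (ent C)"
proof -
  obtain p q r where "supported_below p (ent A)" "supported_below q (ent B)"
      "supported_below r (ent C)"
    using ent_supported by metis
  then have "supported_below (p + q + r) (ent A)" "supported_below (p + q + r) (ent B)"
      "supported_below (p + q + r) (ent C)"
    by (auto elim: supported_below_mono)
  then show ?thesis
    by (rule that)
qed

lemma ent_zero: "ent (0 :: 'a fmat) i j = 0"
  unfolding zero_fmat_def by (subst ent_Mat[of 0]) (auto simp: supported_below_def)

lemma ent_add: "ent (A + B) i j = ent A i j + ent B i j"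
proof -
  obtain n where "supported_below n (ent A)" "supported_below n (ent B)"
    using ent_supported_common by blast
  then show ?thesis
    unfolding plus_fmat_def by (subst ent_Mat[of n]) (auto simp: supported_below_def)
qed

lemma ent_diff: "ent (A - B) i j = ent A i j - ent B i j"
proof -
  obtain n where "supported_below n (ent A)" "supported_below n (ent B)"
    using ent_supported_common by blast
  then show ?thesis
    unfolding minus_fmat_def by (subst ent_Mat[of n]) (auto simp: supported_below_def)
qed

lemma ent_uminus: "ent (- A) i j = - ent A i j"
proof -
  obtain n where "supported_below n (ent A)"
    using ent_supported by blast
  then show ?thesis
    unfolding uminus_fmat_def by (subst ent_Mat[of n]) (auto simp: supported_below_def)
qed

lemma ent_times: "ent (A * B) = ent A **\<^sub>\<infinity> ent B"
proof -
  obtain n where "supported_below n (ent A)" "supported_below n (ent B)"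
    using ent_supported_common by blast
  then show ?thesis
    unfolding times_fmat_def by (intro ent_Mat[of n] supported_below_mult)
qed

lemma ent_times_lessThan:
  "supported_below n (ent A) \<Longrightarrow> ent (A * B) i k = (\<Sum>j<n. ent A i j * ent B j k)"
  by (simp add: ent_times inf_mat_mult_lessThan)

instance
proof
  fix A B C :: "'a fmat"
  \<comment> \<open>One size for all three matrices turns each product into a finite sum over the
    same range, so that \<open>sum.swap\<close> applies.\<close>
  obtain n where n: "supported_below n (ent A)" "supported_below n (ent B)"
      "supported_below n (ent C)"
    using ent_supported_common .
  then have AB: "supported_below n (ent (A * B))"
    by (simp add: ent_times supported_below_mult)
  show "A * B * C = A * (B * C)"
  proof (rule fmat_eqI)
    fix i l
    have "ent (A * B * C) i l = (\<Sum>k<n. \<Sum>j<n. ent A i j * ent B j k * ent C k l)"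
      by (simp add: ent_times_lessThan[OF AB] ent_times_lessThan[OF n(1)] sum_distrib_right)
    also have "\<dots> = (\<Sum>j<n. \<Sum>k<n. ent A i j * ent B j k * ent C k l)"
      by (rule sum.swap)
    also have "\<dots> = ent (A * (B * C)) i l"
      by (simp add: ent_times_lessThan[OF n(2)] ent_times_lessThan[OF n(1)] sum_distrib_left
          mult.assoc)
    finally show "ent (A * B * C) i l = ent (A * (B * C)) i l" .
  qed
  have ApB: "supported_below n (ent (A + B))"
    using n by (auto simp: supported_below_def ent_add)
  show "(A + B) * C = A * C + B * C"
    by (rule fmat_eqI) (simp add: ent_add ent_times_lessThan[OF ApB] ent_times_lessThan[OF n(1)]
        ent_times_lessThan[OF n(2)] distrib_right sum.distrib)
  show "A * (B + C) = A * B + A * C"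
    by (rule fmat_eqI) (simp add: ent_add ent_times_lessThan[OF n(1)] distrib_left sum.distrib)
qed (auto intro!: fmat_eqI simp: ent_add ent_zero ent_diff ent_uminus)

end

section \<open>Matrices with at most one entry per row or per column\<close>

lemma supported_rows_cols:
  assumes "finite I"
  shows "\<exists>n. supported_below n (\<lambda>i j. if i \<in> I \<and> j = f i then x i else 0)"
    and "\<exists>n. supported_below n (\<lambda>i j. if j \<in> I \<and> i = f j then x j else 0)"
proof -
  obtain n where "\<forall>k\<in>I \<union> f ` I. k < n"
    using assms by (metis finite_UnI finite_imageI finite_nat_set_iff_bounded)
  then have "supported_below n (\<lambda>i j. if i \<in> I \<and> j = f i then x i else 0)"
    "supported_below n (\<lambda>i j. if j \<in> I \<and> i = f j then x j else 0)"
    by (auto simp: supported_below_def not_le[symmetric])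
  then show "\<exists>n. supported_below n (\<lambda>i j. if i \<in> I \<and> j = f i then x i else 0)"
    and "\<exists>n. supported_below n (\<lambda>i j. if j \<in> I \<and> i = f j then x j else 0)"
    by blast+
qed

text \<open>Left multiplication by \<open>row_mat I f x\<close> puts \<open>x i\<close> times row
  \<open>f i\<close> into row \<open>i\<close>; \<open>col_mat\<close> does the same for columns on
  the right. Shifts, matrix units, diagonal matrices and column vectors are all instances.\<close>

definition row_mat :: "nat set \<Rightarrow> (nat \<Rightarrow> nat) \<Rightarrow> (nat \<Rightarrow> 'a::ring) \<Rightarrow> 'a fmat" where
  "row_mat I f x = Mat (\<lambda>i j. if i \<in> I \<and> j = f i then x i else 0)"

definition col_mat :: "nat set \<Rightarrow> (nat \<Rightarrow> nat) \<Rightarrow> (nat \<Rightarrow> 'a::ring) \<Rightarrow> 'a fmat" where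
  "col_mat I f x = Mat (\<lambda>i j. if j \<in> I \<and> i = f j then x j else 0)"

definition single :: "nat \<Rightarrow> nat \<Rightarrow> 'a::ring \<Rightarrow> 'a fmat" where
  "single i j s = row_mat {i} (\<lambda>_. j) (\<lambda>_. s)"

definition diag :: "nat \<Rightarrow> (nat \<Rightarrow> 'a::ring) \<Rightarrow> 'a fmat" where
  "diag n d = row_mat {..<n} (\<lambda>i. i) d"

lemma ent_row_mat:
  "finite I \<Longrightarrow> ent (row_mat I f x) i j = (if i \<in> I \<and> j = f i then x i else 0)"
  using supported_rows_cols(1)[of I f x] by (auto simp: row_mat_def ent_Mat)

lemma ent_col_mat:
  "finite I \<Longrightarrow> ent (col_mat I f x) i j = (if j \<in> I \<and> i = f j then x j else 0)"
  using supported_rows_cols(2)[of I f x] by (auto simp: col_mat_def ent_Mat)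

lemma ent_row_mat_times:
  assumes "finite I"
  shows "ent (row_mat I f x * A) i j = (if i \<in> I then x i * ent A (f i) j else 0)"
proof -
  obtain n where "supported_below n (ent (row_mat I f x))" "supported_below n (ent A)"
    using ent_supported_common by blast
  then have "ent (row_mat I f x * A) i j =
      (\<Sum>k<n. (if i \<in> I \<and> k = f i then x i else 0) * ent A k j)"
    by (simp only: ent_times_lessThan ent_row_mat assms)
  also have "\<dots> = (\<Sum>k<n. if k = f i then (if i \<in> I then x i * ent A k j else 0) else 0)"
    by (rule sum.cong) auto
  finally have *: "ent (row_mat I f x * A) i j = \<dots>" .
  show ?thesis
    using \<open>supported_below n (ent A)\<close> unfolding * by (auto simp: supported_below_def not_less)
qed

lemma ent_times_col_mat:
  assumes "finite I"
  shows "ent (A * col_mat I f x) i j = (if j \<in> I then ent A i (f j) * x j else 0)"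
proof -
  obtain n where "supported_below n (ent A)"
    using ent_supported by blast
  then have "ent (A * col_mat I f x) i j =
      (\<Sum>k<n. ent A i k * (if j \<in> I \<and> k = f j then x j else 0))"
    by (simp only: ent_times_lessThan ent_col_mat assms)
  also have "\<dots> = (\<Sum>k<n. if k = f j then (if j \<in> I then ent A i k * x j else 0) else 0)"
    by (rule sum.cong) auto
  finally have *: "ent (A * col_mat I f x) i j = \<dots>" .
  show ?thesis
    using \<open>supported_below n (ent A)\<close> unfolding * by (auto simp: supported_below_def not_less)
qed

text \<open>With a constant index map, \<open>row_mat\<close> is a column vector placed in column
  \<open>c\<close>; this is the matrix-vector product.\<close>

lemma ent_times_row_mat_const:
  assumes "finite I"
  shows "ent (A * row_mat I (\<lambda>_. c) x) i c = (\<Sum>k\<in>I. ent A i k * x k)"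
proof -
  obtain n where n: "supported_below n (ent A)"
    using ent_supported by blast
  then have "ent (A * row_mat I (\<lambda>_. c) x) i c = (\<Sum>k<n. if k \<in> I then ent A i k * x k else 0)"
    by (simp add: ent_times_lessThan ent_row_mat assms) (rule sum.cong, auto)
  also have "\<dots> = (\<Sum>k\<in>{..<n} \<inter> I. ent A i k * x k)"
    by (simp add: sum.inter_restrict)
  also have "\<dots> = (\<Sum>k\<in>I. ent A i k * x k)"
    by (rule sum.mono_neutral_left)
      (use assms n in \<open>auto simp: supported_below_def not_le[symmetric]\<close>)
  finally show ?thesis .
qed

lemma single_eq_col_mat: "single i j s = col_mat {j} (\<lambda>_. i) (\<lambda>_. s)"
  by (rule fmat_eqI) (auto simp: single_def ent_row_mat ent_col_mat)

lemma diag_eq_col_mat: "diag n d = col_mat {..<n} (\<lambda>i. i) d"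
  by (rule fmat_eqI) (auto simp: diag_def ent_row_mat ent_col_mat)

lemma ent_single: "ent (single i j s) k l = (if k = i \<and> l = j then s else 0)"
  by (auto simp: single_def ent_row_mat)

lemma ent_single_times: "ent (single i j s * A) k l = (if k = i then s * ent A j l else 0)"
  by (simp add: single_def ent_row_mat_times)

lemma ent_times_single: "ent (A * single i j s) k l = (if l = j then ent A k i * s else 0)"
  by (simp add: single_eq_col_mat ent_times_col_mat)

lemma ent_diag: "ent (diag n d) i j = (if i = j \<and> i < n then d i else 0)"
  by (auto simp: diag_def ent_row_mat)

lemma ent_diag_times: "ent (diag n d * A) i j = (if i < n then d i * ent A i j else 0)"
  by (simp add: diag_def ent_row_mat_times)

lemma ent_times_diag: "ent (A * diag n d) i j = (if j < n then ent A i j * d j else 0)"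
  by (simp add: diag_eq_col_mat ent_times_col_mat)

lemmas ent_simps = ent_zero ent_add ent_diff ent_uminus ent_single ent_single_times
  ent_times_single ent_diag ent_diag_times ent_times_diag

abbreviation idm :: "nat \<Rightarrow> 'a::ring_1 fmat" where
  "idm n \<equiv> diag n (\<lambda>_. 1)"

lemma single_times_single: "single i j s * single k l t = (if j = k then single i l (s * t) else 0)"
  by (rule fmat_eqI) (auto simp: ent_simps)

lemma idm_times: "supported_below n (ent A) \<Longrightarrow> idm n * A = A"
  by (rule fmat_eqI) (auto simp: ent_simps supported_below_def)

lemma times_idm: "supported_below n (ent A) \<Longrightarrow> A * idm n = A"
  by (rule fmat_eqI) (auto simp: ent_simps supported_below_def)

subsection \<open>The preorder on matrices over the whole ring\<close>

definition fmat_le :: "'a::ring fmat \<Rightarrow> 'a fmat \<Rightarrow> bool" (infix "\<preceq>" 50) where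
  "A \<preceq> B \<longleftrightarrow> (\<exists>X Y. A = X * B * Y)"

lemma fmat_leI: "A = X * B * Y \<Longrightarrow> A \<preceq> B"
  by (auto simp: fmat_le_def)

lemma fmat_le_refl: "A \<preceq> A" for A :: "'a::ring_1 fmat"
proof -
  obtain n where "supported_below n (ent A)"
    using ent_supported by blast
  then show ?thesis
    by (intro fmat_leI[of _ "idm n" _ "idm n"]) (simp add: idm_times times_idm)
qed

lemma fmat_le_trans:
  assumes "A \<preceq> B" "B \<preceq> C"
  shows "A \<preceq> C"
proof -
  obtain X Y X' Y' where "A = X * B * Y" "B = X' * C * Y'"
    using assms by (auto simp: fmat_le_def)
  then have "A = (X * X') * C * (Y' * Y)"
    by (simp add: mult.assoc)
  then show ?thesis
    by (rule fmat_leI)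
qed

text \<open>The outer factors are selection matrices weighted by \<open>x\<close> and
  \<open>y\<close>; injectivity of \<open>f\<close> makes the off-diagonal entries of the product
  vanish.\<close>

lemma diag_le_diag:
  assumes inj: "inj_on f {..<n}"
    and f: "\<And>k. k < n \<Longrightarrow> f k < m \<and> (\<exists>x y. d k = x * e (f k) * y)"
  shows "diag n d \<preceq> diag m e"
proof -
  obtain x y where xy: "\<And>k. k < n \<Longrightarrow> d k = x k * e (f k) * y k"
    using f by metis
  have "diag n d = row_mat {..<n} f x * diag m e * col_mat {..<n} f y"
    by (rule fmat_eqI) (use inj f xy in
        \<open>auto simp: ent_row_mat_times ent_times_col_mat ent_diag mult.assoc inj_on_def\<close>)
  then show ?thesis
    by (rule fmat_leI)
qed

subsection \<open>Chain conditions and ideals\<close>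

text \<open>Applied to divisibility among the entries of a row, it yields a pivot generating the
  right ideal of the row. Totality with \<open>i = j\<close> supplies reflexivity.\<close>

lemma finite_total_greatest:
  assumes "finite K" "K \<noteq> {}"
    and total: "\<And>i j. i \<in> K \<Longrightarrow> j \<in> K \<Longrightarrow> P i j \<or> P j i"
    and trans: "\<And>i j k. P i j \<Longrightarrow> P j k \<Longrightarrow> P i k"
  shows "\<exists>m\<in>K. \<forall>j\<in>K. P j m"
  using assms(1-3)
proof (induction K rule: finite_ne_induct)
  case (singleton i)
  then show ?case by blast
next
  case (insert i K)
  then obtain m where m: "m \<in> K" "\<forall>j\<in>K. P j m"
    by blast
  have "P i m \<or> P m i" "P i i"
    using insert.prems m(1) by blast+
  then show ?case
    using m trans by blast
qed

definition right_dvd :: "'a::times \<Rightarrow> 'a \<Rightarrow> bool" (infix "rdvd" 50) where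
  "y rdvd x \<longleftrightarrow> (\<exists>r. x = y * r)"

lemma right_dvd_trans: "y rdvd x \<Longrightarrow> z rdvd y \<Longrightarrow> z rdvd x" for x y z :: "'a::ring_1"
  by (auto simp: right_dvd_def mult.assoc)

text \<open>Induction on the number of equations: the coefficient \<open>q l p\<close> left-divides
  every coefficient of equation \<open>l\<close>, so this equation can be solved for the unknown
  \<open>p\<close>. A coordinate 1, rather than merely a nonzero one, is demanded because it has to
  leave a diagonal entry unchanged under multiplication.\<close>

lemma right_chain_kernel_vector:
  fixes q :: "nat \<Rightarrow> nat \<Rightarrow> 'a::ring_1"
  assumes chain: "\<And>x y :: 'a. y rdvd x \<or> x rdvd y"
    and "finite L" "finite K" "card L < card K"
  shows "\<exists>x. (\<forall>i\<in>L. (\<Sum>j\<in>K. q i j * x j) = 0) \<and> (\<exists>j\<in>K. x j = 1)"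
  using assms(2-4)
proof (induction L arbitrary: K q rule: finite_induct)
  case empty
  then have "K \<noteq> {}"
    by auto
  then show ?case
    by (auto intro!: exI[of _ "\<lambda>_. 1"])
next
  case (insert l L)
  then have "K \<noteq> {}"
    by auto
  then obtain p where p: "p \<in> K" "\<forall>j\<in>K. q l p rdvd q l j"
    using finite_total_greatest[of K "\<lambda>j m. q l m rdvd q l j"] insert.prems(1) chain
      right_dvd_trans by metis
  then obtain s where s: "\<And>j. j \<in> K \<Longrightarrow> q l j = q l p * s j"
    unfolding right_dvd_def by metis
  have "card L < card (K - {p})"
    using insert p by auto
  then obtain x where x: "\<And>i. i \<in> L \<Longrightarrow> (\<Sum>j\<in>K - {p}. (q i j - q i p * s j) * x j) = 0"
      and one: "\<exists>j\<in>K - {p}. x j = 1"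
    using insert.IH[of "K - {p}" "\<lambda>i j. q i j - q i p * s j"] insert.prems(1) by blast
  \<comment> \<open>The value at \<open>p\<close> solves equation \<open>l\<close>; all other
    coordinates are kept, so the coordinate 1 found in \<open>K - {p}\<close> survives.\<close>
  define z where "z = x(p := - (\<Sum>j\<in>K - {p}. s j * x j))"
  have z: "(\<Sum>j\<in>K. q i j * z j) = (\<Sum>j\<in>K - {p}. (q i j - q i p * s j) * x j)" for i
  proof -
    have "(\<Sum>j\<in>K. q i j * z j) = q i p * z p + (\<Sum>j\<in>K - {p}. q i j * z j)"
      using p(1) insert.prems(1) by (simp add: sum.remove)
    also have "(\<Sum>j\<in>K - {p}. q i j * z j) = (\<Sum>j\<in>K - {p}. q i j * x j)"
      by (rule sum.cong) (auto simp: z_def)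
    finally show ?thesis
      by (simp add: z_def sum_distrib_left left_diff_distrib sum_subtractf mult.assoc)
  qed
  have "(\<Sum>j\<in>K. q i j * z j) = 0" if "i \<in> insert l L" for i
  proof (cases "i = l")
    case True
    then show ?thesis
      unfolding z by (intro sum.neutral) (use s in auto)
  next
    case False
    then show ?thesis
      using that x z by simp
  qed
  moreover have "\<exists>j\<in>K. z j = 1"
    using one by (auto simp: z_def)
  ultimately show ?case
    by blast
qed

section \<open>Two-sided ideals and the counting invariant\<close>

lemma two_sided_idealD:
  assumes "two_sided_ideal I"
  shows "0 \<in> I" "x \<in> I \<Longrightarrow> y \<in> I \<Longrightarrow> x - y \<in> I" "x \<in> I \<Longrightarrow> y \<in> I \<Longrightarrow> x + y \<in> I"
    "x \<in> I \<Longrightarrow> r * x \<in> I" "x \<in> I \<Longrightarrow> x * r \<in> I"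
proof -
  show 0: "0 \<in> I" and diff: "\<And>x y. x \<in> I \<Longrightarrow> y \<in> I \<Longrightarrow> x - y \<in> I"
    and "x \<in> I \<Longrightarrow> r * x \<in> I" "x \<in> I \<Longrightarrow> x * r \<in> I"
    using assms by (auto simp: two_sided_ideal_def left_ideal_def right_ideal_def)
  show "x \<in> I \<Longrightarrow> y \<in> I \<Longrightarrow> x + y \<in> I"
    using diff[of x "0 - y"] diff[of 0 y] 0 by simp
qed

lemma two_sided_ideal_sum:
  "two_sided_ideal I \<Longrightarrow> (\<And>k. k \<in> K \<Longrightarrow> g k \<in> I) \<Longrightarrow> sum g K \<in> I"
  by (induction K rule: infinite_finite_induct) (auto intro: two_sided_idealD)

lemma ent_times_in_ideal:
  assumes "two_sided_ideal I"
  shows "(\<And>j. ent A i j \<in> I) \<Longrightarrow> ent (A * B) i k \<in> I"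
    and "(\<And>j. ent B j k \<in> I) \<Longrightarrow> ent (A * B) i k \<in> I"
proof -
  obtain n where "supported_below n (ent A)"
    using ent_supported by blast
  then have *: "ent (A * B) i k = (\<Sum>j<n. ent A i j * ent B j k)"
    by (rule ent_times_lessThan)
  show "(\<And>j. ent A i j \<in> I) \<Longrightarrow> ent (A * B) i k \<in> I"
    unfolding * by (intro two_sided_ideal_sum two_sided_idealD(5) assms)
  show "(\<And>j. ent B j k \<in> I) \<Longrightarrow> ent (A * B) i k \<in> I"
    unfolding * by (intro two_sided_ideal_sum two_sided_idealD(4) assms)
qed

text \<open>Otherwise some column vector \<open>x\<close> supported on \<open>K\<close> has a
  coordinate 1 at \<open>p\<close>, while \<open>Y * x\<close> vanishes on \<open>L\<close>. The
  remaining coordinates of \<open>diag m e * Y * x\<close> are multiples of entries of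
  \<open>e\<close> in \<open>I\<close>, so the coordinate \<open>p\<close> of
  \<open>diag n d * x\<close>, which is \<open>d p\<close>, would lie in \<open>I\<close>.\<close>

lemma diag_le_diag_card_le:
  fixes d e :: "nat \<Rightarrow> 'a::ring_1"
  assumes chain: "\<And>x y :: 'a. y rdvd x \<or> x rdvd y"
    and I: "two_sided_ideal I"
    and le: "diag n d \<preceq> diag m e"
  shows "card {k. k < n \<and> d k \<notin> I} \<le> card {k. k < m \<and> e k \<notin> I}"
proof (rule ccontr)
  define K where "K = {k. k < n \<and> d k \<notin> I}"
  define L where "L = {k. k < m \<and> e k \<notin> I}"
  assume "\<not> ?thesis"
  then have KL: "card L < card K" "finite K" "finite L"
    by (auto simp: K_def L_def)
  obtain X Y where XY: "diag n d = X * diag m e * Y"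
    using le by (auto simp: fmat_le_def)
  obtain x p where x: "\<And>i. i \<in> L \<Longrightarrow> (\<Sum>j\<in>K. ent Y i j * x j) = 0" and p: "p \<in> K" "x p = 1"
    using right_chain_kernel_vector[OF chain KL(3,2,1), of "ent Y"] by blast
  define V where "V = row_mat K (\<lambda>_. 0) x"
  have "ent (Y * V) i 0 = 0" if "i \<in> L" for i
    using x[OF that] KL by (simp add: V_def ent_times_row_mat_const)
  then have "ent (diag m e * (Y * V)) i 0 \<in> I" for i
    using I by (cases "i \<in> L") (auto simp: ent_diag_times L_def intro: two_sided_idealD)
  then have "ent (X * (diag m e * (Y * V))) p 0 \<in> I"
    by (rule ent_times_in_ideal(2)[OF I])
  moreover have "X * (diag m e * (Y * V)) = diag n d * V"
    by (simp add: XY mult.assoc)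
  moreover have "ent (diag n d * V) p 0 = d p"
    using p KL by (simp add: ent_diag_times V_def ent_row_mat K_def)
  ultimately show False
    using p by (simp add: K_def)
qed

lemma right_ideal_multiples: "right_ideal {x. z rdvd x}" for z :: "'a::ring_1"
  unfolding right_ideal_def right_dvd_def
  by (auto simp: mult.assoc right_diff_distrib[symmetric]) (metis mult_zero_right)

lemma left_ideal_multiples: "left_ideal {x. \<exists>r. x = r * z}" for z :: "'a::ring_1"
  unfolding left_ideal_def
  by (auto simp: mult.assoc[symmetric] left_diff_distrib[symmetric]) (metis mult_zero_left)

lemma two_sided_ideal_zero: "two_sided_ideal {0 :: 'a::ring_1}"
  by (simp add: two_sided_ideal_def left_ideal_def right_ideal_def)

lemma ent_times_zero_row: "(\<And>j. ent A i j = 0) \<Longrightarrow> ent (A * B) i k = 0"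
  for A :: "'a::ring_1 fmat"
  using ent_times_in_ideal(1)[OF two_sided_ideal_zero, of A i B k] by simp

abbreviation fmat_equiv :: "'a::ring fmat \<Rightarrow> 'a fmat \<Rightarrow> bool" (infix "\<simeq>" 50) where
  "A \<simeq> B \<equiv> A \<preceq> B \<and> B \<preceq> A"

lemma fmat_equiv_trans: "A \<simeq> B \<Longrightarrow> B \<simeq> C \<Longrightarrow> A \<simeq> C"
  by (meson fmat_le_trans)

subsection \<open>Block sums\<close>

definition block :: "nat \<Rightarrow> 'a::ring fmat \<Rightarrow> 'a fmat \<Rightarrow> 'a fmat" where
  "block n A B = Mat (block_sum n (ent A) (ent B))"

lemma ent_block: "ent (block n A B) = block_sum n (ent A) (ent B)"
proof -
  obtain m where "supported_below m (ent B)"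
    using ent_supported by blast
  then have "supported_below (n + m) (block_sum n (ent A) (ent B))"
    by (auto simp: supported_below_def block_sum_def)
  then show ?thesis
    unfolding block_def by (rule ent_Mat)
qed

text \<open>Turns the case distinction of a block sum into a ring expression, in which monotonicity
  becomes an algebraic identity.\<close>

lemma block_eq:
  fixes A B :: "'a::ring_1 fmat"
  assumes "supported_below n (ent A)" "supported_below N (ent B)"
  shows "block n A B = A + row_mat {n..<n + N} (\<lambda>i. i - n) (\<lambda>_. 1) * B *
    col_mat {n..<n + N} (\<lambda>i. i - n) (\<lambda>_. 1)"
  by (rule fmat_eqI) (use assms in \<open>auto simp: ent_block block_sum_def ent_add
      ent_times_col_mat ent_row_mat_times supported_below_def\<close>)

lemma block_mono:
  fixes A B C D :: "'a::ring_1 fmat"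
  assumes "A \<preceq> C" "B \<preceq> D" "supported_below n (ent A)" "supported_below m (ent C)"
  shows "block n A B \<preceq> block m C D"
proof -
  obtain X Y where A: "A = X * C * Y"
    using assms(1) by (auto simp: fmat_le_def)
  obtain X' Y' where B: "B = X' * D * Y'"
    using assms(2) by (auto simp: fmat_le_def)
  obtain N where N: "supported_below N (ent B)" "supported_below N (ent D)"
    using ent_supported_common by metis
  \<comment> \<open>\<open>S k\<close> shifts rows down by \<open>k\<close> and \<open>T k\<close>
    shifts columns to the right by \<open>k\<close>. The width \<open>N\<close> bounds both
    \<open>B\<close> and \<open>D\<close>, so the same shifts serve both.\<close>
  define S where "S k = row_mat {k..<k + N} (\<lambda>i. i - k) (\<lambda>_. 1 :: 'a)" for k
  define T where "T k = col_mat {k..<k + N} (\<lambda>i. i - k) (\<lambda>_. 1 :: 'a)" for k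
  have T: "T k = row_mat {..<N} (\<lambda>i. i + k) (\<lambda>_. 1)" for k
    by (rule fmat_eqI) (auto simp: T_def ent_row_mat ent_col_mat)
  have TS: "T m * S m = idm N"
    by (rule fmat_eqI) (auto simp: T S_def ent_row_mat_times ent_row_mat ent_diag)
  have IS: "idm m * S m = 0"
    by (rule fmat_eqI) (auto simp: S_def ent_simps ent_row_mat)
  have TI: "T m * idm m = 0"
    by (rule fmat_eqI) (auto simp: T_def ent_simps ent_col_mat)
  have IC: "idm m * C = C" "C * idm m = C"
    using assms(4) by (simp_all add: idm_times times_idm)
  have TC: "T m * C = 0"
    by (metis IC(1) TI mult.assoc mult_zero_left)
  have CS: "C * S m = 0"
    by (metis IC(2) IS mult.assoc mult_zero_right)
  have ID: "idm N * D = D" "D * idm N = D"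
    using N(2) by (simp_all add: idm_times times_idm)
  \<comment> \<open>Lets the simplifier apply a product rule at the head of a longer product nested
    to the right.\<close>
  have assoc: "P * (Q * Z) = R * Z" if "P * Q = R" for P Q R Z :: "'a fmat"
    using that by (simp add: mult.assoc[symmetric])
  \<comment> \<open>Block sums of \<open>X\<close> with \<open>X'\<close> and of \<open>Y\<close>
    with \<open>Y'\<close>. The factors \<open>idm\<close> cut off entries of \<open>X\<close> and
    \<open>Y\<close> beyond the first blocks, so that all cross terms vanish.\<close>
  define L where "L = idm n * X * idm m + S n * X' * T m"
  define M where "M = idm m * Y * idm n + S m * Y' * T n"
  note rules = TS IS TI IC TC CS ID
  have "L * (C + S m * D * T m) * M = idm n * A * idm n + S n * B * T n"
    unfolding L_def M_def A B by (simp add: algebra_simps rules rules[THEN assoc])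
  also have "\<dots> = block n A B"
    using assms(3) N(1) by (simp add: idm_times times_idm block_eq S_def T_def)
  also have "C + S m * D * T m = block m C D"
    using assms(4) N(2) by (simp add: block_eq S_def T_def)
  finally show ?thesis
    by (intro fmat_leI) (rule sym)
qed

lemma block_diag_diag:
  "block n (diag n d) (diag m e) = diag (n + m) (\<lambda>k. if k < n then d k else e (k - n))"
  by (rule fmat_eqI) (auto simp: ent_block block_sum_def ent_diag)

definition std_diag :: "'a::ring_1 \<Rightarrow> nat \<Rightarrow> nat \<Rightarrow> 'a fmat" where
  "std_diag a r s = diag (r + s) (\<lambda>k. if k < r then 1 else a)"

lemma supported_below_std_diag: "supported_below (r + s) (ent (std_diag a r s))"
  by (simp add: std_diag_def supported_below_def ent_diag)

lemma std_diag_zero: "std_diag a 0 0 = 0"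
  by (rule fmat_eqI) (simp add: std_diag_def ent_simps)

subsection \<open>Nearly simple domains\<close>

context
  assumes nsd: "nearly_simple_domain TYPE('a::ring_1_no_zero_divisors)"
begin

abbreviation (input) J :: "'a set" where
  "J \<equiv> jacobson_radical"

lemma right_chain: "y rdvd x \<or> x rdvd y" for x y :: 'a
proof -
  have "{a. x rdvd a} \<subseteq> {a. y rdvd a} \<or> {a. y rdvd a} \<subseteq> {a. x rdvd a}"
    using nsd right_ideal_multiples[of x] right_ideal_multiples[of y]
    unfolding nearly_simple_domain_def uniserial_def by (metis (lifting))
  moreover have "z rdvd z" for z :: 'a
    unfolding right_dvd_def by (rule exI[of _ 1]) simp
  ultimately show ?thesis
    by blast
qed

lemma left_chain: "(\<exists>r. x = r * y) \<or> (\<exists>r. y = r * x)" for x y :: 'a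
proof -
  have "{a. \<exists>r. a = r * x} \<subseteq> {a. \<exists>r. a = r * y} \<or> {a. \<exists>r. a = r * y} \<subseteq> {a. \<exists>r. a = r * x}"
    using nsd left_ideal_multiples[of x] left_ideal_multiples[of y]
    unfolding nearly_simple_domain_def uniserial_def by (metis (lifting))
  moreover have "\<exists>r. z = r * z" for z :: 'a
    by (rule exI[of _ 1]) simp
  ultimately show ?thesis
    by blast
qed

lemma two_sided_ideal_J: "two_sided_ideal J"
  and two_sided_ideal_cases: "two_sided_ideal I \<Longrightarrow> I = {0} \<or> I = J \<or> I = UNIV"
  using nsd by (auto simp: nearly_simple_domain_def)

lemmas J_closed = two_sided_idealD[OF two_sided_ideal_J]

text \<open>If J were 0 or R, the list of two-sided ideals would shrink to 0 and R, and the ring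
  would be simple.\<close>

lemma J_proper: "J \<noteq> {0}" "J \<noteq> UNIV"
  using nsd two_sided_ideal_cases by (auto simp: nearly_simple_domain_def simple_ring_def)

lemma J_nonzero_element: "\<exists>a\<in>J. a \<noteq> 0"
  using J_proper(1) J_closed(1) by blast

lemma one_notin_J: "1 \<notin> J"
  using J_proper(2) J_closed(4)[of 1] by auto

text \<open>A maximal right ideal omitting \<open>x\<close> is comparable with the right ideal
  generated by \<open>x\<close>, hence properly contained in it, so the latter is the whole ring.
  Cancelling \<open>x\<close> in \<open>x * (y * x) = x\<close> makes the right inverse
  two-sided.\<close>

lemma unit_if_notin_J:
  assumes "x \<notin> J"
  shows "\<exists>y. x * y = 1 \<and> y * x = 1"
proof -
  obtain M where M: "maximal_right_ideal M" "x \<notin> M"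
    using assms by (auto simp: jacobson_radical_def)
  have "x \<noteq> 0"
    using assms J_closed(1) by blast
  have I: "right_ideal {a. x rdvd a}"
    by (rule right_ideal_multiples)
  have x: "x \<in> {a. x rdvd a}"
    by (auto simp: right_dvd_def intro: exI[of _ 1])
  then have "M \<subseteq> {a. x rdvd a}"
    using nsd I M unfolding nearly_simple_domain_def uniserial_def maximal_right_ideal_def by blast
  then have "{a. x rdvd a} = UNIV"
    using I M x unfolding maximal_right_ideal_def by blast
  then have "1 \<in> {a. x rdvd a}"
    by simp
  then obtain y where y: "x * y = 1"
    by (auto simp: right_dvd_def)
  then have "x * (y * x) = x * 1"
    by (simp add: mult.assoc[symmetric])
  then show ?thesis
    using y \<open>x \<noteq> 0\<close> by (auto simp del: mult_1_right)
qed

text \<open>Comparability of right ideals makes the set of products \<open>r * a * t\<close> closed under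
  subtraction, so it is all of \<open>J\<close>.\<close>

lemma J_element_between:
  assumes "a \<in> J" "a \<noteq> 0" "b \<in> J"
  shows "\<exists>r\<in>J. \<exists>t\<in>J. b = r * a * t"
proof -
  define I where "I = {r * a * t | r t. r \<in> J \<and> t \<in> J}"
  have I_I: "r * a * t \<in> I" if "r \<in> J" "t \<in> J" for r t
    using that by (auto simp: I_def)
  have diff: "x - y \<in> I" if xy: "x \<in> I" "y \<in> I" for x y
  proof -
    obtain r t where x: "x = r * a * t" "r \<in> J" "t \<in> J"
      using xy(1) by (auto simp: I_def)
    obtain r' t' where y: "y = r' * a * t'" "r' \<in> J" "t' \<in> J"
      using xy(2) by (auto simp: I_def)
    \<comment> \<open>If \<open>x = y * v\<close>, both terms share the left part
      \<open>r' * a\<close>, and the difference only changes the right factor, which stays in J; the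
      other case is analogous.\<close>
    consider v where "x = y * v" | v where "y = x * v"
      using right_chain[of x y] by (auto simp: right_dvd_def)
    then show ?thesis
    proof cases
      case 1
      then have "x - y = r' * a * (t' * (v - 1))"
        by (simp add: y(1) algebra_simps)
      then show ?thesis
        using y J_closed(5) I_I by simp
    next
      case 2
      then have "x - y = r * a * (t * (1 - v))"
        by (simp add: x(1) algebra_simps)
      then show ?thesis
        using x J_closed(5) I_I by simp
    qed
  qed
  have "two_sided_ideal I"
    unfolding two_sided_ideal_def left_ideal_def right_ideal_def
  proof (intro conjI ballI allI)
    show "0 \<in> I" "0 \<in> I"
      using I_I[of 0 0] J_closed(1) by auto
    fix x r assume "x \<in> I"
    then obtain p t where x: "x = p * a * t" "p \<in> J" "t \<in> J"
      by (auto simp: I_def)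
    have "r * x = (r * p) * a * t" "x * r = p * a * (t * r)"
      by (simp_all add: x(1) mult.assoc)
    then show "r * x \<in> I" "x * r \<in> I"
      using I_I x J_closed(4,5) by metis+
  qed (fact diff)+
  moreover have "I \<subseteq> J"
    by (auto simp: I_def J_closed(4,5))
  \<comment> \<open>The product \<open>a * a * a\<close> lies in \<open>I\<close> and is nonzero in
    a domain.\<close>
  moreover have "I \<noteq> {0}"
    using I_I[OF assms(1,1)] assms(2) by auto
  ultimately have "I = J"
    using two_sided_ideal_cases J_proper(2) by blast
  then have "b \<in> I"
    using assms(3) by simp
  then show ?thesis
    by (auto simp: I_def)
qed

text \<open>By comparability of left ideals, the current \<open>x\<close> is replaced by
  \<open>p\<close> whenever \<open>p\<close> is not a left multiple of it. Starting from a nonzero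
  element of J keeps \<open>x\<close> nonzero even if all of \<open>S\<close> is zero.\<close>

lemma common_right_factor:
  assumes "finite S" "S \<subseteq> J"
  shows "\<exists>x\<in>J. x \<noteq> 0 \<and> (\<forall>p\<in>S. \<exists>r. p = r * x)"
  using assms
proof (induction S rule: finite_induct)
  case empty
  then show ?case
    using J_nonzero_element by blast
next
  case (insert p S)
  then obtain x where x: "x \<in> J" "x \<noteq> 0" "\<forall>q\<in>S. \<exists>r. q = r * x"
    by blast
  show ?case
  proof (cases "\<exists>r. p = r * x")
    case True
    with x show ?thesis by blast
  next
    case False
    then obtain u where u: "x = u * p"
      using left_chain by blast
    have "\<exists>r. q = r * p" if "q \<in> insert p S" for q
      using that x(3) u by (metis insertE mult.assoc mult_1_left)
    moreover have "p \<noteq> 0"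
      using u x(2) by auto
    ultimately show ?thesis
      using insert.prems by blast
  qed
qed

text \<open>An Ore condition for finitely many pairs: if \<open>c k * y\<close> is not a right
  multiple of \<open>e k\<close>, then \<open>e k = c k * y * u\<close>, and passing to
  \<open>y * u\<close> preserves the earlier divisibilities. With it a pivot column is cancelled
  against diagonal entries already found.\<close>

lemma common_right_multiplier:
  fixes c e :: "nat \<Rightarrow> 'a"
  assumes "finite K" "\<And>k. k \<in> K \<Longrightarrow> e k \<noteq> 0"
  shows "\<exists>y. y \<noteq> 0 \<and> (\<forall>k\<in>K. e k rdvd c k * y)"
  using assms
proof (induction K rule: finite_induct)
  case empty
  then show ?case
    by (auto intro: exI[of _ 1])
next
  case (insert k K)
  then obtain y where y: "y \<noteq> 0" "\<forall>l\<in>K. e l rdvd c l * y"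
    by auto
  show ?case
  proof (cases "e k rdvd c k * y")
    case True
    with y show ?thesis by blast
  next
    case False
    then obtain u where u: "e k = c k * y * u"
      using right_chain unfolding right_dvd_def by blast
    have "u \<noteq> 0"
      using u insert.prems by auto
    moreover have "e l rdvd c l * (y * u)" if l: "l \<in> insert k K" for l
    proof (cases "l = k")
      case True
      have "c k * (y * u) = e k * 1"
        using u by (simp add: mult.assoc)
      then show ?thesis
        using True unfolding right_dvd_def by blast
    next
      case False
      then obtain v where "c l * y = e l * v"
        using l y unfolding right_dvd_def by blast
      then have "c l * (y * u) = e l * (v * u)"
        by (simp add: mult.assoc[symmetric])
      then show ?thesis
        unfolding right_dvd_def by blast
    qed
    ultimately show ?thesis
      using y(1) by (metis mult_eq_0_iff)
  qed
qed

text \<open>A unit divides its whole row; without units, any nonzero row has an entry dividing the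
  others. Preferring units guarantees that a pivot in J forces all entries into J, which later puts
  the new column of \<open>P\<close> into J.\<close>

lemma ex_pivot:
  fixes A :: "'a fmat"
  assumes "ent A k l \<noteq> 0"
  obtains i j where "ent A i j \<noteq> 0" "\<And>l. ent A i j rdvd ent A i l"
    "ent A i j \<notin> J \<or> (\<forall>k l. ent A k l \<in> J)"
proof (cases "\<forall>k l. ent A k l \<in> J")
  case False
  then obtain i j where ij: "ent A i j \<notin> J"
    by blast
  then obtain h where h: "ent A i j * h = 1"
    using unit_if_notin_J by blast
  have "ent A i l = ent A i j * (h * ent A i l)" for l
    by (simp add: mult.assoc[symmetric] h)
  then have "ent A i j rdvd ent A i l" for l
    unfolding right_dvd_def by blast
  moreover have "ent A i j \<noteq> 0"
    using ij J_closed(1) by auto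
  ultimately show ?thesis
    using that ij by blast
next
  case True
  obtain n where n: "supported_below n (ent A)"
    using ent_supported by blast
  then have "l < n"
    using assms by (auto simp: supported_below_def not_le[symmetric])
  then have "\<exists>j\<in>{..<n}. \<forall>l\<in>{..<n}. ent A k j rdvd ent A k l"
    by (intro finite_total_greatest) (use right_chain right_dvd_trans in auto)
  then obtain j where j: "j < n" "\<forall>l<n. ent A k j rdvd ent A k l"
    by auto
  have "ent A k j rdvd ent A k l" for l
  proof (cases "l < n")
    case False
    then have "ent A k l = ent A k j * 0"
      using n by (simp add: supported_below_def)
    then show ?thesis
      unfolding right_dvd_def by blast
  qed (use j in blast)
  moreover from this[of l] have "ent A k j \<noteq> 0"
    using assms by (auto simp: right_dvd_def)
  ultimately show ?thesis
    using that True by blast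
qed

text \<open>Induction on the number of nonzero rows, splitting off a pivot \<open>g\<close> that generates the
  right ideal of its row. A unit pivot is cleared from its column by row operations; if there is
  no unit entry, then the diagonal matrix obtained for the rest is adapted by choosing a suitable
  right multiple \<open>g * y\<close> of the pivot instead.\<close>

lemma diagonal_factorization:
  fixes A :: "'a fmat"
  shows "\<exists>n e P Q X Y. A = P * Q \<and> X * A * Y = diag n e \<and>
    (\<forall>k\<ge>n. \<forall>i. ent P i k = 0 \<and> ent Q k i = 0 \<and> ent X k i = 0) \<and>
    (\<forall>k<n. e k \<noteq> 0 \<and> (e k = 1 \<or> e k \<in> J \<and> (\<forall>i. ent P i k \<in> J)))"
proof (induction "card {i. \<exists>j. ent A i j \<noteq> 0}" arbitrary: A rule: less_induct)
  case less
  show ?case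
  proof (cases "\<exists>i j. ent A i j \<noteq> 0")
    case False
    then have "A = 0"
      by (intro fmat_eqI) (auto simp: ent_zero)
    moreover have "diag 0 (\<lambda>_. 0) = (0 :: 'a fmat)"
      by (rule fmat_eqI) (simp add: ent_simps)
    ultimately show ?thesis
      by (intro exI[of _ 0] exI[of _ "\<lambda>_. 0"]) (simp add: ent_zero)
  next
    case True
    then obtain i j where g0: "ent A i j \<noteq> 0" and row: "\<And>l. ent A i j rdvd ent A i l"
      and pivot: "ent A i j \<notin> J \<or> (\<forall>k l. ent A k l \<in> J)"
      using ex_pivot by metis
    define g where "g = ent A i j"
    obtain u where u: "\<And>l. ent A i l = g * u l"
      using row unfolding right_dvd_def g_def by metis
    obtain N where N: "supported_below N (ent A)"
      using ent_supported by blast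
    have "j < N"
      using N g0 by (auto simp: supported_below_def not_le[symmetric])
    have "g * u j = g * 1"
      using u[of j] by (simp add: g_def)
    then have uj: "u j = 1"
      using g0 by (simp add: g_def del: mult_1_right)
    \<comment> \<open>The row vector \<open>u\<close> placed in row \<open>n\<close>. The product
      \<open>A * U j\<close> is column \<open>j\<close> of \<open>A\<close> times \<open>u\<close>,
      which agrees with \<open>A\<close> in row \<open>i\<close>; with \<open>n\<close> the current
      size, \<open>U n\<close> becomes the new row of \<open>Q\<close>.\<close>
    define U where "U n = col_mat {..<N} (\<lambda>_. n) u" for n :: nat
    have ent_U: "ent (U n) k l = (if l < N \<and> k = n then u l else 0)" for n k l
      by (simp add: U_def ent_col_mat)
    define A' where "A' = A - A * U j"
    have u0: "u l = 0" if "\<not> l < N" for l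
      using u[of l] N g0 that by (simp add: supported_below_def g_def)
    have row_i: "ent A' i l = 0" for l
      by (simp add: A'_def ent_diff U_def ent_times_col_mat u uj u0)
    have "ent A' k l = 0" if "\<And>l. ent A k l = 0" for k l
      using that by (simp add: A'_def ent_diff ent_times_zero_row)
    with row_i have "{k. \<exists>l. ent A' k l \<noteq> 0} \<subseteq> {k. \<exists>l. ent A k l \<noteq> 0} - {i}"
      by blast
    moreover have "finite {k. \<exists>l. ent A k l \<noteq> 0}"
      by (rule finite_subset[of _ "{..<N}"])
        (use N in \<open>auto simp: supported_below_def not_le[symmetric]\<close>)
    moreover have "i \<in> {k. \<exists>l. ent A k l \<noteq> 0}"
      using g0 by blast
    ultimately have "card {k. \<exists>l. ent A' k l \<noteq> 0} < card {k. \<exists>l. ent A k l \<noteq> 0}"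
      by (meson card_Diff1_less card_mono finite_Diff le_less_trans)
    then obtain n e P Q X Y where PQ: "A' = P * Q" and XY: "X * A' * Y = diag n e"
      and zero: "\<And>k l. n \<le> k \<Longrightarrow> ent P l k = 0" "\<And>k l. n \<le> k \<Longrightarrow> ent Q k l = 0"
        "\<And>k l. n \<le> k \<Longrightarrow> ent X k l = 0"
      and e: "\<And>k. k < n \<Longrightarrow> e k \<noteq> 0"
        "\<And>k. k < n \<Longrightarrow> e k = 1 \<or> e k \<in> J \<and> (\<forall>i. ent P i k \<in> J)"
      using less[of A'] by blast
    \<comment> \<open>\<open>E\<close> moves column \<open>j\<close>, and \<open>F\<close> moves row
      \<open>i\<close>, to the new index \<open>n\<close>; thus \<open>C\<close> is the pivot column
      of \<open>A\<close> in position \<open>n\<close>.\<close>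
    define E F C where "E = single j n (1 :: 'a)" and "F = single n i (1 :: 'a)" and "C = A * E"
    have FA: "F * A = single n n g * U n"
      by (rule fmat_eqI) (simp add: F_def ent_simps ent_U u u0)
    have UE: "U n * E = single n n 1"
      by (rule fmat_eqI) (use uj \<open>j < N\<close> in \<open>auto simp: E_def ent_simps ent_U\<close>)
    have EU: "E * U n = U j"
      by (rule fmat_eqI) (auto simp: E_def ent_simps ent_U)
    have A: "A = A' + C * U n"
      by (simp add: A'_def C_def EU mult.assoc)
    have A'E: "A' * E = 0"
    proof -
      have "A' * E = C - A * E * (U n * E)"
        by (simp add: A'_def C_def EU[symmetric] algebra_simps)
      also have "\<dots> = C - C * single n n 1"
        by (simp add: UE C_def)
      also have "\<dots> = 0"
        by (rule fmat_eqI) (simp add: ent_simps C_def E_def)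
      finally show ?thesis .
    qed
    have FA': "single n i s * A' = 0" for s
      by (rule fmat_eqI) (simp add: ent_simps row_i)
    have C_zero: "ent C k l = 0" if "l \<noteq> n" for k l
      using that by (simp add: C_def E_def ent_simps)
    \<comment> \<open>Common interface of the two kinds of pivot: \<open>X'\<close> acts on
      \<open>A'\<close> as \<open>X\<close> does, and after multiplication by \<open>X'\<close> and
      \<open>y\<close> the pivot column is cancelled by the columns of \<open>diag n e\<close> with
      coefficients \<open>z\<close>. A unit pivot takes \<open>y = h\<close> and
      \<open>z = 0\<close>; otherwise \<open>X' = X\<close>.\<close>
    obtain X' y z where X': "\<And>k l. n \<le> k \<Longrightarrow> ent X' k l = 0" "X' * A' = X * A'"
      and yz: "\<And>k. k < n \<Longrightarrow> ent (X' * C) k n * y + e k * z k = 0" "y \<noteq> 0"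
      and gy: "g * y = 1 \<or> g * y \<in> J \<and> (\<forall>k l. ent A k l \<in> J)"
    proof (cases "g \<in> J")
      case False
      then obtain h where h: "g * h = 1" "h * g = 1"
        using unit_if_notin_J by blast
      \<comment> \<open>\<open>single n i h * C\<close> is the matrix unit at \<open>(n, n)\<close>,
        so \<open>X' * C = 0\<close>, while the action on \<open>A'\<close> is unaffected because
        row \<open>i\<close> of \<open>A'\<close> vanishes.\<close>
      define X' where "X' = X - X * C * single n i h"
      have "ent X' k l = 0" if "n \<le> k" for k l
        using zero(3)[OF that] by (simp add: X'_def ent_diff mult.assoc ent_times_zero_row)
      moreover have "X' * A' = X * A'"
        using FA' by (simp add: X'_def left_diff_distrib mult.assoc)
      moreover have "X' * C = 0"
      proof -
        have "single n i h * C = single n n h * (F * A) * E"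
          by (simp add: C_def F_def mult.assoc[symmetric] single_times_single)
        also have "\<dots> = single n n h * single n n g * (U n * E)"
          by (simp add: FA mult.assoc)
        also have "\<dots> = single n n 1"
          by (simp add: UE single_times_single h)
        finally have "single n i h * C = single n n 1" .
        moreover have "C * single n n 1 = C"
          by (rule fmat_eqI) (simp add: ent_simps C_zero)
        ultimately show ?thesis
          by (simp add: X'_def left_diff_distrib mult.assoc)
      qed
      moreover have "h \<noteq> 0"
        using h by auto
      ultimately show ?thesis
        using h by (intro that[of X' h "\<lambda>_. 0"]) (auto simp: ent_zero)
    next
      case True
      obtain y where y: "y \<noteq> 0" "\<And>k. k < n \<Longrightarrow> e k rdvd ent (X * C) k n * y"
        using common_right_multiplier[of "{..<n}" e "\<lambda>k. ent (X * C) k n"] e(1) by auto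
      then obtain z where "\<And>k. k < n \<Longrightarrow> ent (X * C) k n * y = e k * z k"
        unfolding right_dvd_def by metis
      then show ?thesis
        using y True pivot zero(3) by (intro that[of X y "\<lambda>k. - z k"]) (auto simp: g_def J_closed)
    qed
    define Z where "Z = row_mat {..<n} (\<lambda>_. n) z"
    \<comment> \<open>Only row \<open>j\<close> of \<open>Y\<close> changes, and
      \<open>U n * Y' = 0\<close>; since column \<open>j\<close> of \<open>A'\<close> is zero, this
      gives \<open>A * Y' = A' * Y\<close>.\<close>
    define Y' where "Y' = Y - E * U n * Y"
    define e' where "e' = e(n := g * y)"
    have "U n * Y' = U n * Y - single n n 1 * U n * Y"
      by (simp add: Y'_def right_diff_distrib mult.assoc[symmetric] UE)
    also have "\<dots> = 0"
      by (rule fmat_eqI) (simp add: mult.assoc ent_simps, simp add: ent_times_zero_row ent_U)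
    finally have UY': "U n * Y' = 0" .
    have "A * Y' = A' * Y' + C * (U n * Y')"
      by (subst A) (simp add: algebra_simps)
    also have "\<dots> = A' * Y - A' * E * U n * Y"
      unfolding UY' by (simp add: Y'_def right_diff_distrib mult.assoc)
    also have "\<dots> = A' * Y"
      by (simp add: A'E)
    finally have XAY': "X' * A * Y' = diag n e"
      using X'(2) XY by (simp add: mult.assoc) (simp add: mult.assoc[symmetric])
    have FAY': "F * A * Y' = 0"
      by (simp add: FA mult.assoc UY')
    have FAE: "F * A * single j n y = single n n (g * y)"
    proof -
      have "F * A * single j n y = single n n g * (U n * E) * single n n y"
        by (simp add: FA E_def mult.assoc single_times_single)
      then show ?thesis
        by (simp add: UE single_times_single)
    qed
    \<comment> \<open>\<open>F\<close> selects the pivot row. The term \<open>single j n y\<close>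
      brings the pivot column times \<open>y\<close> into column \<open>n\<close>, and
      \<open>Y' * Z\<close> cancels its entries above the new diagonal entry
      \<open>g * y\<close>.\<close>
    have "(X' + F) * A * (Y' + single j n y + Y' * Z) =
        X' * A * Y' + X' * A * single j n y + X' * A * Y' * Z +
        F * A * Y' + F * A * single j n y + F * A * Y' * Z"
      by (simp add: algebra_simps)
    also have "\<dots> = diag n e + (X' * C * single n n y + diag n e * Z) + single n n (g * y)"
      by (simp add: XAY' FAY' FAE) (simp add: C_def E_def mult.assoc single_times_single)
    also have "X' * C * single n n y + diag n e * Z = 0"
      by (rule fmat_eqI) (use yz(1) X'(1) in
        \<open>auto simp: ent_simps Z_def ent_row_mat ent_times_zero_row not_less\<close>)
    also have "diag n e + 0 + single n n (g * y) = diag (Suc n) e'"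
      by (rule fmat_eqI) (auto simp: ent_simps e'_def)
    finally have XAY: "(X' + F) * A * (Y' + single j n y + Y' * Z) = diag (Suc n) e'" .
    \<comment> \<open>The cross terms of \<open>(P + C) * (Q + U n)\<close> vanish: \<open>P\<close>
      and \<open>Q\<close> use only inner indices below \<open>n\<close>, whereas \<open>C\<close>
      and \<open>U n\<close> use only the index \<open>n\<close>.\<close>
    have "P * U n = 0"
    proof -
      have "P * U n = P * single n n 1 * U n"
        unfolding mult.assoc by (rule arg_cong[of _ _ "(*) P"], rule fmat_eqI)
          (simp add: ent_simps ent_U)
      also have "P * single n n 1 = 0"
        by (rule fmat_eqI) (simp add: ent_simps zero)
      finally show ?thesis by simp
    qed
    moreover have "C * Q = 0"
    proof -
      have "C * Q = A * (E * Q)"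
        by (simp add: C_def mult.assoc)
      also have "E * Q = 0"
        by (rule fmat_eqI) (simp add: E_def ent_simps zero)
      finally show ?thesis by simp
    qed
    ultimately have "A = (P + C) * (Q + U n)"
      using A PQ by (simp add: algebra_simps)
    moreover have "\<forall>k\<ge>Suc n. \<forall>i. ent (P + C) i k = 0 \<and> ent (Q + U n) k i = 0 \<and>
        ent (X' + F) k i = 0"
      using zero X'(1) by (simp add: ent_add C_zero ent_U F_def ent_single)
    moreover have "\<forall>k<Suc n. e' k \<noteq> 0 \<and>
        (e' k = 1 \<or> e' k \<in> J \<and> (\<forall>i. ent (P + C) i k \<in> J))"
    proof (intro allI impI)
      fix k assume "k < Suc n"
      then consider "k < n" | "k = n"
        by linarith
      then show "e' k \<noteq> 0 \<and> (e' k = 1 \<or> e' k \<in> J \<and> (\<forall>i. ent (P + C) i k \<in> J))"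
      proof cases
        case 1
        then show ?thesis
          using e[of k] by (simp add: e'_def ent_add C_zero)
      next
        case 2
        have "g * y \<noteq> 0"
          using g0 yz(2) by (simp add: g_def)
        then show ?thesis
          using 2 gy by (auto simp: e'_def ent_add zero C_def E_def ent_times_single)
      qed
    qed
    ultimately show ?thesis
      using XAY by blast
  qed
qed

lemma nonzero_between:
  assumes "x \<noteq> 0" "y \<noteq> 0" "x \<in> J \<longleftrightarrow> y \<in> J"
  shows "\<exists>r t. x = r * y * t"
proof (cases "y \<in> J")
  case True
  then show ?thesis
    using J_element_between[of y x] assms by blast
next
  case False
  then obtain h where "h * y = 1"
    using unit_if_notin_J by blast
  then have "x = (x * h) * y * 1"
    by (simp add: mult.assoc)
  then show ?thesis
    by blast
qed

text \<open>Units are matched with units and elements of J with elements of J; the two injections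
  glue because membership in J separates their images.\<close>

lemma diag_le_diag_if_card_le:
  assumes d: "\<And>k. k < n \<Longrightarrow> d k \<noteq> 0" and e: "\<And>k. k < m \<Longrightarrow> e k \<noteq> 0"
    and units: "card {k. k < n \<and> d k \<notin> J} \<le> card {k. k < m \<and> e k \<notin> J}"
    and nonunits: "card {k. k < n \<and> d k \<in> J} \<le> card {k. k < m \<and> e k \<in> J}"
  shows "diag n d \<preceq> diag m e"
proof -
  obtain f where f: "inj_on f {k. k < n \<and> d k \<notin> J}"
      "f ` {k. k < n \<and> d k \<notin> J} \<subseteq> {k. k < m \<and> e k \<notin> J}"
    using units inj_on_iff_card_le[of "{k. k < n \<and> d k \<notin> J}" "{k. k < m \<and> e k \<notin> J}"] by auto
  obtain f' where f': "inj_on f' {k. k < n \<and> d k \<in> J}"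
      "f' ` {k. k < n \<and> d k \<in> J} \<subseteq> {k. k < m \<and> e k \<in> J}"
    using nonunits inj_on_iff_card_le[of "{k. k < n \<and> d k \<in> J}" "{k. k < m \<and> e k \<in> J}"] by auto
  define h where "h k = (if d k \<in> J then f' k else f k)" for k
  have h: "h k < m" "d k \<in> J \<longleftrightarrow> e (h k) \<in> J" if "k < n" for k
    using that f(2) f'(2) by (auto simp: h_def image_subset_iff)
  have "inj_on h {..<n}"
  proof (rule inj_onI)
    fix k l assume kl: "k \<in> {..<n}" "l \<in> {..<n}" "h k = h l"
    then have "d k \<in> J \<longleftrightarrow> d l \<in> J"
      using h(2) by (metis lessThan_iff)
    with kl f(1) f'(1) show "k = l"
      by (auto simp: h_def inj_on_def split: if_splits)
  qed
  then show ?thesis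
    by (rule diag_le_diag) (use h d e nonzero_between in blast)
qed

section \<open>Normal forms and the passage from R to J\<close>

context
  fixes a :: 'a
  assumes a: "a \<in> J" "a \<noteq> 0"
begin

lemma std_le_std: "std_diag a r' s' \<preceq> std_diag a r s \<longleftrightarrow> r' + s' \<le> r + s \<and> r' \<le> r"
proof
  assume le: "std_diag a r' s' \<preceq> std_diag a r s"
  have "{k. k < r + s \<and> (if k < r then 1 else a) \<notin> {0}} = {..<r + s}" for r s :: nat
    using a by auto
  moreover have "{k. k < r + s \<and> (if k < r then 1 else a) \<notin> J} = {..<r}" for r s :: nat
    using a one_notin_J by auto
  ultimately show "r' + s' \<le> r + s \<and> r' \<le> r"
    using diag_le_diag_card_le[OF right_chain two_sided_ideal_zero le[unfolded std_diag_def]]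
      diag_le_diag_card_le[OF right_chain two_sided_ideal_J le[unfolded std_diag_def]]
    by (simp only: card_lessThan)
next
  assume le: "r' + s' \<le> r + s \<and> r' \<le> r"
  show "std_diag a r' s' \<preceq> std_diag a r s"
    unfolding std_diag_def
  proof (rule diag_le_diag[where f = "\<lambda>k. k"])
    fix k assume "k < r' + s'"
    \<comment> \<open>The left factor is 1 where the two entries agree; for
      \<open>r' \<le> k < r\<close> it is \<open>a\<close>, as \<open>a = a * 1 * 1\<close>.\<close>
    moreover have "(if k < r' then 1 else a) = (if k < r' \<or> r \<le> k then 1 else a) *
        (if k < r then 1 else a) * 1"
      using le by auto
    ultimately show "k < r + s \<and>
        (\<exists>x y. (if k < r' then 1 else a) = x * (if k < r then 1 else a) * y)"
      using le by (meson less_le_trans)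
  qed (auto intro: inj_onI)
qed

lemma diag_equiv_std:
  assumes d: "\<And>k. k < n \<Longrightarrow> d k \<noteq> 0"
    and "card {k. k < n \<and> d k \<notin> J} = r" "card {k. k < n \<and> d k \<in> J} = s"
  shows "diag n d \<simeq> std_diag a r s"
proof -
  have "{k. k < r + s \<and> (if k < r then 1 else a) \<notin> J} = {..<r}"
    "{k. k < r + s \<and> (if k < r then 1 else a) \<in> J} = {r..<r + s}"
    using a one_notin_J by auto
  then have "card {k. k < r + s \<and> (if k < r then 1 else a) \<notin> J} = r"
    "card {k. k < r + s \<and> (if k < r then 1 else a) \<in> J} = s"
    by simp_all
  then show ?thesis
    unfolding std_diag_def using assms a by (intro conjI diag_le_diag_if_card_le) auto
qed

text \<open>A sandwich: \<open>diag n e\<close> lies below \<open>A\<close> by construction.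
  Conversely, column \<open>k\<close> of \<open>P\<close> is written as a column \<open>w k\<close>
  times a nonzero scalar \<open>x k\<close> on the same side of J as \<open>e k\<close>; so
  \<open>A\<close> lies below \<open>diag n x\<close>, and \<open>x k\<close> can be exchanged for
  \<open>e k\<close>.\<close>

lemma ex_equiv_std: "\<exists>r s. A \<simeq> std_diag a r s"
proof -
  obtain n e P Q X Y where PQ: "A = P * Q" and XY: "X * A * Y = diag n e"
    and zero: "\<And>k i. n \<le> k \<Longrightarrow> ent P i k = 0"
    and e: "\<And>k. k < n \<Longrightarrow> e k \<noteq> 0"
      "\<And>k. k < n \<Longrightarrow> e k = 1 \<or> e k \<in> J \<and> (\<forall>i. ent P i k \<in> J)"
    using diagonal_factorization[of A] by blast
  obtain N where N: "supported_below N (ent P)"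
    using ent_supported by blast
  \<comment> \<open>For \<open>e k = 1\<close> the column itself with \<open>x = 1\<close> works.
    Vanishing of \<open>w\<close> from \<open>N\<close> on keeps the matrix built from it finitely
    supported.\<close>
  have "\<exists>x w. x \<noteq> 0 \<and> (x \<in> J \<longleftrightarrow> e k \<in> J) \<and> (\<forall>i. ent P i k = w i * x) \<and> (\<forall>i\<ge>N. w i = 0)"
    if k: "k < n" for k
  proof (cases "e k = 1")
    case True
    then show ?thesis
      using N by (intro exI[of _ 1] exI[of _ "\<lambda>i. ent P i k"]) (simp add: supported_below_def)
  next
    case False
    then have P: "e k \<in> J" "\<And>i. ent P i k \<in> J"
      using e(2)[OF k] by auto
    then have "(\<lambda>i. ent P i k) ` {..<N} \<subseteq> J"
      by auto
    then obtain x where x: "x \<in> J" "x \<noteq> 0" "\<forall>p\<in>(\<lambda>i. ent P i k) ` {..<N}. \<exists>r. p = r * x"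
      using common_right_factor[of "(\<lambda>i. ent P i k) ` {..<N}"] by blast
    then have "\<exists>r. ent P i k = r * x" if "i < N" for i
      using that by blast
    then obtain w where w: "\<And>i. i < N \<Longrightarrow> ent P i k = w i * x"
      by metis
    show ?thesis
      by (intro exI[of _ x] exI[of _ "\<lambda>i. if i < N then w i else 0"])
        (use x(1,2) w N P(1) in \<open>auto simp: supported_below_def\<close>)
  qed
  then obtain x w where x: "\<And>k. k < n \<Longrightarrow> x k \<noteq> 0" "\<And>k. k < n \<Longrightarrow> x k \<in> J \<longleftrightarrow> e k \<in> J"
    and w: "\<And>k i. k < n \<Longrightarrow> ent P i k = w k i * x k" "\<And>k i. k < n \<Longrightarrow> N \<le> i \<Longrightarrow> w k i = 0"
    by metis
  define W where "W = Mat (\<lambda>i k. if k < n then w k i else 0)"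
  have "supported_below (n + N) (\<lambda>i k. if k < n then w k i else 0)"
    using w(2) by (auto simp: supported_below_def)
  then have "ent W = (\<lambda>i k. if k < n then w k i else 0)"
    unfolding W_def by (rule ent_Mat)
  then have "P = W * diag n x"
    by (intro fmat_eqI) (simp add: ent_times_diag w(1) zero)
  then have "A \<preceq> diag n x"
    using PQ by (auto intro: fmat_leI)
  moreover have "diag n x \<preceq> diag n e"
    by (rule diag_le_diag[where f = "\<lambda>k. k"]) (use x e(1) nonzero_between in auto)
  moreover have "diag n e \<preceq> A"
    by (rule fmat_leI[OF XY[symmetric]])
  ultimately have "A \<simeq> diag n e"
    by (meson fmat_le_trans)
  moreover have "diag n e \<simeq> std_diag a (card {k. k < n \<and> e k \<notin> J}) (card {k. k < n \<and> e k \<in> J})"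
    by (rule diag_equiv_std) (use e(1) in auto)
  ultimately show ?thesis
    using fmat_equiv_trans by blast
qed

text \<open>Only the numbers of units and of elements of J matter, so the interleaved diagonal
  requires no explicit permutation.\<close>

lemma block_std: "block (r + s) (std_diag a r s) (std_diag a r' s') \<simeq> std_diag a (r + r') (s + s')"
proof -
  define d where "d k = (if k < r + s then if k < r then 1 else a
    else if k - (r + s) < r' then 1 else a)" for k
  have "{k. k < r + s + (r' + s') \<and> d k \<notin> J} = {..<r} \<union> {r + s..<r + s + r'}"
    "{k. k < r + s + (r' + s') \<and> d k \<in> J} = {r..<r + s} \<union> {r + s + r'..<r + s + r' + s'}"
    using a one_notin_J by (auto simp: d_def split: if_splits)
  then have "card {k. k < r + s + (r' + s') \<and> d k \<notin> J} = r + r'"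
    "card {k. k < r + s + (r' + s') \<and> d k \<in> J} = s + s'"
    by (simp_all add: card_Un_disjoint disjoint_iff)
  then have "diag (r + s + (r' + s')) d \<simeq> std_diag a (r + r') (s + s')"
    by (intro diag_equiv_std) (auto simp: d_def a)
  then show ?thesis
    by (simp add: std_diag_def block_diag_diag d_def[abs_def])
qed

lemma block_equiv_std:
  assumes "supported_below n (ent A)" "A \<simeq> std_diag a r s" "B \<simeq> std_diag a r' s'"
  shows "block n A B \<simeq> std_diag a (r + r') (s + s')"
proof (rule fmat_equiv_trans)
  show "block n A B \<simeq> block (r + s) (std_diag a r s) (std_diag a r' s')"
    using assms supported_below_std_diag by (blast intro: block_mono)
qed (rule block_std)

text \<open>Entries of \<open>X * A * Y\<close> stay in the ideal J, whereas for
  \<open>r > 0\<close> the corner entry of the normal form is 1.\<close>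

lemma ex_equiv_std_J:
  assumes "\<And>i j. ent A i j \<in> J"
  shows "\<exists>s. A \<simeq> std_diag a 0 s"
proof -
  obtain r s where rs: "A \<simeq> std_diag a r s"
    using ex_equiv_std by blast
  then obtain X Y where "std_diag a r s = X * A * Y"
    by (auto simp: fmat_le_def)
  then have "ent (std_diag a r s) 0 0 \<in> J"
    by (simp add: ent_times_in_ideal[OF two_sided_ideal_J] assms)
  then have "r = 0"
    using one_notin_J by (cases r) (auto simp: std_diag_def ent_diag)
  then show ?thesis
    using rs by blast
qed

text \<open>Weak \<open>s\<close>-unitality of \<open>J\<close>, obtained by diagonalizing \<open>A\<close> and factoring \<open>a = r * a * t\<close>
  with \<open>r\<close> and \<open>t\<close> in \<open>J\<close>.\<close>

lemma fmat_weakly_s_unital_J: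
  assumes "\<And>i j. ent A i j \<in> J"
  shows "\<exists>B C. (\<forall>i j. ent B i j \<in> J) \<and> (\<forall>i j. ent C i j \<in> J) \<and> A = B * A * C"
proof -
  obtain s where s: "A \<simeq> std_diag a 0 s"
    using ex_equiv_std_J assms by blast
  then obtain X Y X' Y' where A: "A = X * std_diag a 0 s * Y" and S: "std_diag a 0 s = X' * A * Y'"
    by (auto simp: fmat_le_def)
  obtain r t where rt: "r \<in> J" "t \<in> J" "a = r * a * t"
    using J_element_between[OF a a(1)] by blast
  define E F where "E = diag s (\<lambda>_. r)" and "F = diag s (\<lambda>_. t)"
  have EF: "ent E i j \<in> J" "ent F i j \<in> J" for i j
    using rt J_closed(1) by (auto simp: E_def F_def ent_diag)
  have EsF: "E * std_diag a 0 s * F = std_diag a 0 s"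
    by (rule fmat_eqI) (simp add: std_diag_def E_def F_def ent_simps rt(3)[symmetric])
  have "A = X * (E * std_diag a 0 s * F) * Y"
    unfolding EsF by (rule A)
  \<comment> \<open>Substituting \<open>X' * A * Y'\<close> for the normal form encloses
    \<open>E\<close> and \<open>F\<close>, whose entries lie in J, in the outer products; these
    therefore have entries in J.\<close>
  then have "A = (X * E * X') * A * (Y' * F * Y)"
    unfolding S mult.assoc .
  moreover have "ent (X * E * X') i j \<in> J" "ent (Y' * F * Y) i j \<in> J" for i j
    by (intro ent_times_in_ideal(1)[OF two_sided_ideal_J]
        ent_times_in_ideal(2)[OF two_sided_ideal_J] EF)+
  ultimately show ?thesis
    by blast
qed

text \<open>Substituting \<open>A = X * B * Y\<close> into \<open>A = U * A * V\<close> with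
  \<open>U\<close> and \<open>V\<close> over J absorbs \<open>X\<close> and \<open>Y\<close> into
  factors over the ideal J.\<close>

lemma fmat_le_J:
  assumes "\<And>i j. ent A i j \<in> J" "A \<preceq> B"
  shows "\<exists>X Y. (\<forall>i j. ent X i j \<in> J) \<and> (\<forall>i j. ent Y i j \<in> J) \<and> A = X * B * Y"
proof -
  obtain U V where UV: "\<And>i j. ent U i j \<in> J" "\<And>i j. ent V i j \<in> J" "A = U * A * V"
    using fmat_weakly_s_unital_J[of A] assms(1) by blast
  obtain X Y where "A = X * B * Y"
    using assms(2) by (auto simp: fmat_le_def)
  then have "A = U * (X * B * Y) * V"
    using UV(3) by blast
  then have "A = (U * X) * B * (Y * V)"
    unfolding mult.assoc .
  moreover have "ent (U * X) i j \<in> J" "ent (Y * V) i j \<in> J" for i j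
    by (simp_all add: ent_times_in_ideal[OF two_sided_ideal_J] UV)
  ultimately show ?thesis
    by blast
qed

end

end

subsection \<open>A criterion for the isomorphism type of \<open>W S\<close>\<close>

text \<open>The \<open>\<rho> v\<close> form a transversal indexed by \<open>N\<close>: antisymmetry
  in \<open>N\<close> makes their classes distinct, and \<open>ex_rep\<close> makes them exhaust
  \<open>W S\<close>. The monoid and order laws of \<open>W S\<close> are then transported from
  \<open>N\<close> and never checked on matrices.\<close>

lemma W_isomorphic:
  fixes N :: "'b ordered_monoid" and S :: "'a::ring set"
  assumes N: "ordered_comm_monoid N" "carrier N = UNIV"
    and rep: "\<And>v. \<rho> v \<in> M_inf S"
    and ex_rep: "\<And>f. f \<in> M_inf S \<Longrightarrow> \<exists>v. (f, \<rho> v) \<in> W_rel S"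
    and le: "\<And>v w. precsim1 S (\<rho> v) (\<rho> w) \<longleftrightarrow> ord_le N v w"
    and trans: "\<And>f g h. f \<in> M_inf S \<Longrightarrow> g \<in> M_inf S \<Longrightarrow> h \<in> M_inf S \<Longrightarrow>
      precsim1 S f g \<Longrightarrow> precsim1 S g h \<Longrightarrow> precsim1 S f h"
    and block: "\<And>n f g v w. supported_below n f \<Longrightarrow> (f, \<rho> v) \<in> W_rel S \<Longrightarrow> (g, \<rho> w) \<in> W_rel S \<Longrightarrow>
      (block_sum n f g, \<rho> (v \<otimes>\<^bsub>N\<^esub> w)) \<in> W_rel S"
    and zero: "((\<lambda>i j. 0), \<rho> \<one>\<^bsub>N\<^esub>) \<in> W_rel S"
  shows "ordered_monoid_isomorphic (W S) N"
proof -
  interpret N: ordered_comm_monoid N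
    by (rule N(1))
  have rel_iff: "(f, g) \<in> W_rel S \<longleftrightarrow>
      f \<in> M_inf S \<and> g \<in> M_inf S \<and> precsim1 S f g \<and> precsim1 S g f" for f g
    by (auto simp: W_rel_def)
  have rel_sym: "(g, f) \<in> W_rel S" if "(f, g) \<in> W_rel S" for f g
    using that by (simp add: rel_iff)
  have rel_trans: "(f, h) \<in> W_rel S" if "(f, g) \<in> W_rel S" "(g, h) \<in> W_rel S" for f g h
    using that trans by (simp add: rel_iff) blast
  define c where "c v = W_rel S `` {\<rho> v}" for v
  have class_eq: "W_rel S `` {f} = W_rel S `` {g}" if "(f, g) \<in> W_rel S" for f g
    using that rel_sym rel_trans by blast
  have mem_c: "f \<in> c v \<longleftrightarrow> (f, \<rho> v) \<in> W_rel S" for f v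
    using rel_sym by (auto simp: c_def)
  have rep_c: "\<rho> v \<in> c v" for v
    using N.ord_refl[of v] rep by (simp add: mem_c rel_iff le N(2))
  have inj: "v = w" if "c v = c w" for v w
  proof -
    have "(\<rho> v, \<rho> w) \<in> W_rel S"
      using rep_c[of v] that by (simp add: mem_c)
    then show ?thesis
      using N.ord_antisym by (simp add: rel_iff le N(2))
  qed
  have carrier: "carrier (W S) = range c"
  proof
    show "carrier (W S) \<subseteq> range c"
      using ex_rep class_eq by (fastforce simp: W_def quotient_def c_def)
    show "range c \<subseteq> carrier (W S)"
      using rep by (auto simp: W_def quotient_def c_def)
  qed
  have one: "\<one>\<^bsub>W S\<^esub> = c \<one>\<^bsub>N\<^esub>"
    using class_eq[OF zero] by (simp add: W_def c_def)
  have mult: "c v \<otimes>\<^bsub>W S\<^esub> c w = c (v \<otimes>\<^bsub>N\<^esub> w)" for v w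
  proof -
    have "W_rel S `` {block_sum n f g} = c (v \<otimes>\<^bsub>N\<^esub> w)"
      if "f \<in> c v" "g \<in> c w" "supported_below n f" for n f g
      unfolding c_def by (rule class_eq, rule block) (use that mem_c in auto)
    \<comment> \<open>Makes the union that defines the product nonempty; all its members are one and
      the same class.\<close>
    moreover have "\<exists>n. supported_below n (\<rho> v)"
      using rep by (simp add: M_inf_iff)
    ultimately have "{W_rel S `` {block_sum n f g} | n f g.
        f \<in> c v \<and> g \<in> c w \<and> supported_below n f} = {c (v \<otimes>\<^bsub>N\<^esub> w)}"
      using rep_c by blast
    then show ?thesis
      by (simp add: W_def)
  qed
  have ord: "ord_le (W S) (c v) (c w) \<longleftrightarrow> ord_le N v w" for v w
  proof
    assume "ord_le (W S) (c v) (c w)"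
    then obtain f g where "(f, \<rho> v) \<in> W_rel S" "(g, \<rho> w) \<in> W_rel S" "precsim1 S f g"
      by (auto simp: W_def mem_c)
    then have "precsim1 S (\<rho> v) (\<rho> w)"
      unfolding rel_iff using trans by blast
    then show "ord_le N v w"
      by (simp add: le)
  next
    assume "ord_le N v w"
    then show "ord_le (W S) (c v) (c w)"
      using rep_c by (auto simp: W_def le[symmetric])
  qed
  have "ordered_comm_monoid (W S)"
  proof -
    have "comm_monoid (W S)"
      by (rule comm_monoidI)
        (auto simp: carrier one mult N(2) N.m_ac)
    note ord_N = N.ord_refl N.ord_trans N.ord_mult_mono N.ord_antisym
    from \<open>comm_monoid (W S)\<close> show ?thesis
      by (intro ordered_comm_monoid.intro ordered_comm_monoid_axioms.intro)
        (auto simp: carrier mult ord intro: ord_N(1-3)[unfolded N(2), simplified]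
          dest: ord_N(4)[unfolded N(2), simplified])
  qed
  moreover have c_inv: "inv_into UNIV c (c v) = v" for v
    using inj by (intro inv_f_f injI)
  moreover have "inv_into UNIV c \<in> iso (W S) N"
    by (auto simp: iso_def hom_def carrier mult c_inv N(2) bij_betw_def inj_on_def image_iff)
  ultimately show ?thesis
    unfolding ordered_monoid_isomorphic_def using N(1)
    by (intro conjI bexI[of _ "inv_into UNIV c"]) (auto simp: carrier one ord c_inv)
qed

lemma M_inf_ent: "ent A \<in> M_inf S \<longleftrightarrow> (\<forall>i j. ent A i j \<in> S)"
  by (simp add: M_inf_iff ent_supported)

lemma M_inf_obtain_ent:
  assumes "f \<in> M_inf S"
  obtains A where "f = ent A" "\<And>i j. ent A i j \<in> S"
  using assms Mat_inverse[of f] by (metis M_inf_iff UNIV_I)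

lemma precsim1_ent: "precsim1 S (ent A) (ent B) \<longleftrightarrow>
    (\<exists>X Y. (\<forall>i j. ent X i j \<in> S) \<and> (\<forall>i j. ent Y i j \<in> S) \<and> A = X * B * Y)"
proof
  assume "precsim1 S (ent A) (ent B)"
  then obtain X Y where "\<And>i j. ent X i j \<in> S" "\<And>i j. ent Y i j \<in> S"
      "ent A = ent X **\<^sub>\<infinity> ent B **\<^sub>\<infinity> ent Y"
    unfolding precsim1_def by (metis M_inf_obtain_ent)
  then show "\<exists>X Y. (\<forall>i j. ent X i j \<in> S) \<and> (\<forall>i j. ent Y i j \<in> S) \<and> A = X * B * Y"
    by (auto simp: ent_times[symmetric] ent_inject)
next
  assume "\<exists>X Y. (\<forall>i j. ent X i j \<in> S) \<and> (\<forall>i j. ent Y i j \<in> S) \<and> A = X * B * Y"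
  then show "precsim1 S (ent A) (ent B)"
    unfolding precsim1_def by (metis M_inf_ent ent_times)
qed

text \<open>\<open>le_S\<close> permits working with \<open>\<preceq>\<close> over the full ring:
  for \<open>A\<close> over \<open>S\<close>, outer factors over \<open>S\<close> exist as soon as
  any outer factors do. This is trivial for \<open>UNIV\<close> and is \<open>fmat_le_J\<close> for
  J.\<close>

lemma W_isomorphic_fmat:
  fixes N :: "'b ordered_monoid" and S :: "'a::ring_1 set"
  assumes N: "ordered_comm_monoid N" "carrier N = UNIV"
    and S: "0 \<in> S"
    and le_S: "\<And>A B. (\<And>i j. ent A i j \<in> S) \<Longrightarrow> A \<preceq> B \<Longrightarrow>
      \<exists>X Y. (\<forall>i j. ent X i j \<in> S) \<and> (\<forall>i j. ent Y i j \<in> S) \<and> A = X * B * Y"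
    and rep: "\<And>v i j. ent (\<rho> v) i j \<in> S"
    and ex_rep: "\<And>A. (\<And>i j. ent A i j \<in> S) \<Longrightarrow> \<exists>v. A \<simeq> \<rho> v"
    and le: "\<And>v w. \<rho> v \<preceq> \<rho> w \<longleftrightarrow> ord_le N v w"
    and block: "\<And>n A B v w. supported_below n (ent A) \<Longrightarrow> A \<simeq> \<rho> v \<Longrightarrow> B \<simeq> \<rho> w \<Longrightarrow>
      block n A B \<simeq> \<rho> (v \<otimes>\<^bsub>N\<^esub> w)"
    and zero: "\<rho> \<one>\<^bsub>N\<^esub> = 0"
  shows "ordered_monoid_isomorphic (W S) N"
proof (rule W_isomorphic[OF N, of "\<lambda>v. ent (\<rho> v)"])
  have prec: "precsim1 S (ent A) (ent B) \<longleftrightarrow> A \<preceq> B" if "\<And>i j. ent A i j \<in> S" for A B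
    unfolding precsim1_ent using le_S[of A B] that fmat_leI by blast
  have rel: "(ent A, ent B) \<in> W_rel S \<longleftrightarrow>
      (\<forall>i j. ent A i j \<in> S) \<and> (\<forall>i j. ent B i j \<in> S) \<and> A \<simeq> B" for A B
    using prec by (auto simp: W_rel_def M_inf_ent)
  show "ent (\<rho> v) \<in> M_inf S" for v
    by (simp add: M_inf_ent rep)
  show "\<exists>v. (f, ent (\<rho> v)) \<in> W_rel S" if "f \<in> M_inf S" for f
    using that by (elim M_inf_obtain_ent) (simp add: rel rep ex_rep)
  show "precsim1 S (ent (\<rho> v)) (ent (\<rho> w)) \<longleftrightarrow> ord_le N v w" for v w
    by (simp add: prec rep le)
  show "precsim1 S f h" if fgh: "f \<in> M_inf S" "g \<in> M_inf S" "h \<in> M_inf S"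
    "precsim1 S f g" "precsim1 S g h" for f g h
  proof -
    obtain A B C where "f = ent A" "\<And>i j. ent A i j \<in> S" "g = ent B" "\<And>i j. ent B i j \<in> S"
        "h = ent C"
      using fgh(1-3) by (metis M_inf_obtain_ent)
    then show ?thesis
      using fgh(4,5) fmat_le_trans[of A B C] by (simp add: prec)
  qed
  show "(block_sum n f g, ent (\<rho> (v \<otimes>\<^bsub>N\<^esub> w))) \<in> W_rel S"
    if fg: "supported_below n f" "(f, ent (\<rho> v)) \<in> W_rel S" "(g, ent (\<rho> w)) \<in> W_rel S" for n f g v w
  proof -
    have "f \<in> M_inf S" "g \<in> M_inf S"
      using fg by (auto simp: W_rel_def)
    then obtain A B where AB: "f = ent A" "\<And>i j. ent A i j \<in> S" "g = ent B" "\<And>i j. ent B i j \<in> S"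
      by (metis M_inf_obtain_ent)
    then have "ent (block n A B) i j \<in> S" for i j
      by (simp add: ent_block block_sum_def S)
    moreover have "block n A B \<simeq> \<rho> (v \<otimes>\<^bsub>N\<^esub> w)"
      by (rule block) (use fg in \<open>simp_all add: AB rel\<close>)
    ultimately show ?thesis
      by (simp add: AB ent_block[symmetric] rel rep)
  qed
  have "(\<lambda>i j. 0) = ent (0 :: 'a fmat)"
    by (simp add: fun_eq_iff ent_zero)
  then show "((\<lambda>i j. 0), ent (\<rho> \<one>\<^bsub>N\<^esub>)) \<in> W_rel S"
    by (simp add: zero rel ent_zero S fmat_le_refl)
qed

lemma ordered_comm_monoid_nat: "ordered_comm_monoid nat_ordered_monoid"
  by unfold_locales (auto simp: nat_ordered_monoid_def)

lemma ordered_comm_monoid_nat_pair: "ordered_comm_monoid nat_pair_ordered_monoid"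
  by unfold_locales (auto simp: nat_pair_ordered_monoid_def)

theorem theorem8p4:
  assumes "nearly_simple_domain TYPE('a::ring_1_no_zero_divisors)"
  shows "ordered_monoid_isomorphic (W (jacobson_radical :: 'a set)) nat_ordered_monoid
    \<and> ordered_monoid_isomorphic (W (UNIV :: 'a set)) nat_pair_ordered_monoid"
proof
  obtain a :: 'a where a: "a \<in> jacobson_radical" "a \<noteq> 0"
    using J_nonzero_element[OF assms] by blast
  show "ordered_monoid_isomorphic (W (jacobson_radical :: 'a set)) nat_ordered_monoid"
  proof (rule W_isomorphic_fmat[where \<rho> = "std_diag a 0"])
    show "ent (std_diag a 0 s) i j \<in> jacobson_radical" for s i j
      by (simp add: std_diag_def ent_diag a J_closed(1)[OF assms])
    show "block n A B \<simeq> std_diag a 0 (s \<otimes>\<^bsub>nat_ordered_monoid\<^esub> s')"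
      if "supported_below n (ent A)" "A \<simeq> std_diag a 0 s" "B \<simeq> std_diag a 0 s'" for n A B s s'
      using block_equiv_std[OF assms a that] by (simp add: nat_ordered_monoid_def)
    show "\<exists>X Y. (\<forall>i j. ent X i j \<in> jacobson_radical) \<and> (\<forall>i j. ent Y i j \<in> jacobson_radical) \<and>
        A = X * B * Y"
      if "\<And>i j. ent A i j \<in> jacobson_radical" "A \<preceq> B" for A B :: "'a fmat"
      by (rule fmat_le_J[OF assms a that])
  qed (simp_all add: ordered_comm_monoid_nat J_closed(1)[OF assms]
      ex_equiv_std_J[OF assms a] std_le_std[OF assms a] std_diag_zero,
      simp_all add: nat_ordered_monoid_def std_le_std[OF assms a] std_diag_zero)
  show "ordered_monoid_isomorphic (W (UNIV :: 'a set)) nat_pair_ordered_monoid"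
  proof (rule W_isomorphic_fmat[where \<rho> = "\<lambda>(r, s). std_diag a r s"])
    show "\<exists>v. A \<simeq> (case v of (r, s) \<Rightarrow> std_diag a r s)" for A
      using ex_equiv_std[OF assms a, of A] by auto
    show "block n A B \<simeq> (case v \<otimes>\<^bsub>nat_pair_ordered_monoid\<^esub> w of (r, s) \<Rightarrow> std_diag a r s)"
      if "supported_below n (ent A)" "A \<simeq> (case v of (r, s) \<Rightarrow> std_diag a r s)"
        "B \<simeq> (case w of (r, s) \<Rightarrow> std_diag a r s)" for n A B v w
      using that block_equiv_std[OF assms a]
      by (cases v; cases w) (auto simp: nat_pair_ordered_monoid_def)
    show "\<exists>X Y. (\<forall>i j. ent X i j \<in> UNIV) \<and> (\<forall>i j. ent Y i j \<in> UNIV) \<and> A = X * B * Y"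
      if "A \<preceq> B" for A B :: "'a fmat"
      using that by (simp add: fmat_le_def)
  qed (simp_all add: ordered_comm_monoid_nat_pair,
      auto simp: nat_pair_ordered_monoid_def std_le_std[OF assms a] std_diag_zero)
qed

end
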